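(* Let $A(z)$ be an entire function of finite non-integral order with $\rho(A)>1$, let $p$ be the genus of $A(z)$, and suppose that all the zeros of $A(z)$ lie in the angular sector $\theta_1<\arg z<\theta_2$, where $$\theta_2-\theta_1<\frac{\pi}{p+1}\quad\text{if } p \text{ is odd},$$ and $$\theta_2-\theta_1<\frac{(2p-1)\pi}{2p(p+1)}\quad\text{if } p \text{ is even}.$$ Let $B(z)$ be a transcendental entire function with a multiply connected Fatou component. Then every non-trivial solution $f$ of $$f''+A(z)f'+B(z)f=0$$ is of infinite order.
   Context: All solutions of $f''+A(z)f'+B(z)f=0$ with $A,B$ entire are entire functions; "non-trivial" means not identically zero. For an entire function $f$, $M(r,f)=\max\{|f(z)|:|z|=r\}$ and the order is $\rho(f)=\limsup_{r\to\infty}\frac{\log^+ \log^+ M(r,f)}{\log r}\in[0,\infty]$; $f$ is of infinite order if $\rho(f)=\infty$. The genus of an entire function of finite order is the genus in the sense of its Hadamard factorization (the maximum of the degree of the polynomial in the exponential factor and the genus of the canonical product over its zeros). The Fatou set of an entire function $B$ is the set of points of $\mathbb{C}$ having a neighbourhood on which the iterates $B^{\circ n}$, $n\ge 1$, form a normal family; a Fatou component is a connected component of the Fatou set, and it is multiply connected if it is not simply connected. *)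

theory Defs
  imports "HOL-Complex_Analysis.Complex_Analysis"
begin

(* For r >= 0 and f continuous the supremum is attained, so this is the maximum modulus. *)
definition max_modulus :: "(complex \<Rightarrow> complex) \<Rightarrow> real \<Rightarrow> real" where
  "max_modulus f r = (SUP z\<in>sphere 0 r. norm (f z))"

(* The positive part of the logarithm; the value at 0 is 0. *)
definition log_plus :: "real \<Rightarrow> real" where
  "log_plus x = ln (max 1 x)"

definition growth_order :: "(complex \<Rightarrow> complex) \<Rightarrow> ereal" where
  "growth_order f =
     Limsup at_top (\<lambda>r::real. ereal (log_plus (log_plus (max_modulus f r)) / ln r))"

(* The canonical product is indexed by nat. The nonzero terms of the sequence a are the nonzero
   zeros of the product, repeated according to multiplicity; terms a n = 0 are mere padding
   (needed if there are only finitely many zeros): since z / 0 = 0, such a term contributes the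
   factor weierstrass_factor k 0 = 1 to the product and 0 to the series. *)
definition canonical_product_genus :: "(nat \<Rightarrow> complex) \<Rightarrow> nat \<Rightarrow> bool" where
  "canonical_product_genus a k \<longleftrightarrow>
     summable (\<lambda>n. (1 / norm (a n)) ^ Suc k) \<and>
     (\<forall>j<k. \<not> summable (\<lambda>n. (1 / norm (a n)) ^ Suc j))"

(* Hadamard factorization f z = z^m exp (Q z) P z, with P the canonical product of genus k.
   For f entire of finite order, not identically zero, exactly one p satisfies this. *)
definition has_genus :: "(complex \<Rightarrow> complex) \<Rightarrow> nat \<Rightarrow> bool" where
  "has_genus f p \<longleftrightarrow>
     (\<exists>m Q a k P. canonical_product_genus a k \<and>
        (\<forall>z. (\<lambda>n. weierstrass_factor k (z / a n)) has_prod P z) \<and>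
        (\<forall>z. f z = z ^ m * exp (poly Q z) * P z) \<and>
        p = max (degree Q) k)"

(* The origin, having no argument, is not in the sector. *)
definition sector :: "real \<Rightarrow> real \<Rightarrow> complex set" where
  "sector \<theta>1 \<theta>2 = {rcis r \<theta> | r \<theta>. 0 < r \<and> \<theta>1 < \<theta> \<and> \<theta> < \<theta>2}"

(* Normality in the sense of Montel for holomorphic functions on a domain (open connected set) U;
   locally uniform convergence to the constant infinity is allowed. *)
definition normal_family_on :: "complex set \<Rightarrow> (complex \<Rightarrow> complex) set \<Rightarrow> bool" where
  "normal_family_on U F \<longleftrightarrow>
     (\<forall>s::nat \<Rightarrow> complex \<Rightarrow> complex. range s \<subseteq> F \<longrightarrow>
        (\<exists>r::nat \<Rightarrow> nat. strict_mono r \<and>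
           ((\<exists>g. \<forall>K. compact K \<and> K \<subseteq> U \<longrightarrow> uniform_limit K (s \<circ> r) g sequentially) \<or>
            (\<forall>K. compact K \<and> K \<subseteq> U \<longrightarrow>
               (\<forall>C. \<forall>\<^sub>F n in sequentially. \<forall>z\<in>K. C \<le> norm (s (r n) z))))))"

(* Restricting to connected neighbourhoods loses nothing, as every neighbourhood contains a disc. *)
definition Fatou_set :: "(complex \<Rightarrow> complex) \<Rightarrow> complex set" where
  "Fatou_set f =
     {z. \<exists>U. open U \<and> connected U \<and> z \<in> U \<and> normal_family_on U {f ^^ n | n. 1 \<le> n}}"

definition transcendental_entire :: "(complex \<Rightarrow> complex) \<Rightarrow> bool" where
  "transcendental_entire f \<longleftrightarrow> f holomorphic_on UNIV \<and> \<not> (\<exists>q. \<forall>z. f z = poly q z)"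

end

theory Submission
  imports Defs
begin

text \<open>Suppose \<open>f\<close> has finite order. Three facts about points on rays are incompatible with the equation.

  Since the order of \<open>A\<close> is not an integer, the genus \<open>p\<close> is that of the canonical product and
  the sum of \<open>norm (a n) powr - p\<close> over the zeros diverges. The width of the sector leaves room for
  directions in which every primary factor decreases like \<open>exp (- c * (t / norm (a n)) ^ p)\<close>;
  divergence makes the product beat the exponential factor, so \<open>A\<close> is bounded by 1 there.

  A closed curve in a multiply connected Fatou component that encloses a point of the Julia set is
  mapped by suitable iterates to curves that surround large discs and on which, by Harnack's inequality for
  the logarithm of the modulus of two consecutive iterates, both the variable and \<open>B\<close> vary by at
  most a fixed power. As \<open>B\<close> is transcendental, \<open>B\<close> is larger than any given power of the variable
  on such a curve, and every ray from the origin meets the curve.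

  Finally, among more rays than there are zeros of \<open>f\<close> in a disc, one stays away from all of them,
  and on it the quotients of \<open>f'\<close> and \<open>f''\<close> by \<open>f\<close> are polynomially bounded.\<close>

subsection \<open>Factoring out zeros\<close>

text \<open>The order of the choices is what makes the three facts fit. A ray that avoids the zeros
  of \<open>f\<close> is available only up to a prescribed radius \<open>R\<close> and moves with
  \<open>R\<close>; this replaces the usual exceptional sets for logarithmic derivatives. It does no
  harm, because \<open>A\<close> is bounded uniformly on a whole interval of directions and the
  lower bound for \<open>B\<close> is met on every ray. The curve lies between the moduli
  \<open>m\<close> and \<open>m ^ C\<close>, where \<open>C\<close> counts Harnack steps on one
  fixed curve and so is the same for all iterates and all powers. Hence taking
  \<open>R = m ^ C\<close> costs only \<open>m ^ (C * K)\<close>, and the power of \<open>m\<close>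
  that \<open>B\<close> has to reach can be prescribed once \<open>C\<close> and \<open>K\<close>
  are known. Finite order of \<open>f\<close> is felt through one number \<open>T\<close>, the
  logarithm of the growth of \<open>f\<close> on a disc, which is at most a power of
  \<open>R\<close>: it bounds both the number of zeros and the inverse of the scale on which
  \<open>f\<close> is nearly constant.\<close>

text \<open>A Borel-Caratheodory estimate in Harnack form. The Cayley transform \<open>w\<close>
  sends the right half-plane to the unit disc and \<open>h a\<close> to 0, so the Schwarz lemma
  gives \<open>norm (w u) \<le> norm u\<close>, which is then solved for \<open>h z - h a\<close>.
  With \<open>x = 1 / 2\<close> real parts grow at most threefold; small \<open>x\<close> controls
  oscillation.\<close>

lemma holomorphic_positive_Re_bound:
  assumes h: "h holomorphic_on ball a r" and pos: "\<And>z. z \<in> ball a r \<Longrightarrow> 0 < Re (h z)"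
    and z: "norm (z - a) \<le> x * r" and x: "x < 1" and r: "0 < r"
  shows "norm (h z - h a) \<le> 2 * x / (1 - x) * Re (h a)"
proof -
  have x0: "0 \<le> x" using z r
    by (smt (verit) norm_ge_zero mult_neg_pos)
  have ha: "0 < Re (h a)" using pos r by simp
  define w where "w = (\<lambda>u::complex. (h (a + r * u) - h a) / (h (a + r * u) + cnj (h a)))"
  have inb: "a + r * u \<in> ball a r" if "norm u < 1" for u :: complex
    using that r by (simp add: dist_norm norm_mult)
  have nz: "h (a + r * u) + cnj (h a) \<noteq> 0" if "norm u < 1" for u :: complex
  proof -
    have "0 < Re (h (a + r * u) + cnj (h a))" using pos[OF inb[OF that]] ha by simp
    then show ?thesis by (metis less_irrefl zero_complex.sel(1))
  qed
  have hol: "(\<lambda>u::complex. h (a + r * u)) holomorphic_on ball 0 1"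
    by (rule holomorphic_on_compose_gen[OF _ h, unfolded o_def])
       (auto intro!: holomorphic_intros inb)
  have w_hol: "w holomorphic_on ball 0 1"
    unfolding w_def using nz by (intro holomorphic_intros hol) auto
  have w_less: "norm (w u) < 1" if "norm u < 1" for u :: complex
  proof -
    define p q where "p = h (a + r * u)" and "q = h a"
    have pq: "0 < Re p" "0 < Re q" using pos[OF inb[OF that]] ha by (auto simp: p_def q_def)
    have "(norm (p - q))\<^sup>2 < (norm (p + cnj q))\<^sup>2"
      using mult_pos_pos[OF pq] unfolding cmod_power2 by (simp add: power2_eq_square algebra_simps)
    then have "norm (p - q) < norm (p + cnj q)"
      using power_less_imp_less_base[of _ 2] by force
    moreover have "0 < norm (p + cnj q)"
      using calculation norm_ge_zero[of "p - q"] by linarith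
    ultimately show ?thesis unfolding w_def p_def[symmetric] q_def[symmetric]
      by (simp add: norm_divide)
  qed
  define u where "u = (z - a) / r"
  have nu: "norm u \<le> x" using z r by (simp add: u_def norm_divide field_simps)
  then have nu1: "norm u < 1" using x by simp
  have zu: "a + r * u = z" using r by (simp add: u_def)
  have "norm (w u) \<le> norm u"
    by (rule Schwarz_Lemma(1)[OF w_hol _ w_less nu1]) (auto simp: w_def)
  then have wx: "norm (w u) \<le> x" using nu by simp
  have eq: "h z + cnj (h a) = (h z - h a) + complex_of_real (2 * Re (h a))"
    by (simp add: complex_eq_iff)
  have "norm (h z - h a) = norm (w u) * norm (h z + cnj (h a))"
    using nz[OF nu1] unfolding w_def zu by (simp add: norm_divide)
  also have "\<dots> \<le> x * (norm (h z - h a) + 2 * Re (h a))"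
  proof (rule mult_mono[OF wx _ x0])
    show "norm (h z + cnj (h a)) \<le> norm (h z - h a) + 2 * Re (h a)"
      unfolding eq using norm_triangle_ineq[of "h z - h a" "complex_of_real (2 * Re (h a))"] ha
      by simp
  qed simp
  finally have "norm (h z - h a) * (1 - x) \<le> 2 * x * Re (h a)" by (simp add: algebra_simps)
  then show ?thesis using x by (simp add: pos_le_divide_eq)
qed

lemma entire_divide_zero:
  assumes "g holomorphic_on UNIV" and "g a = 0"
  obtains g' where "g' holomorphic_on UNIV" and "\<And>z. g z = (z - a) * g' z"
proof
  show "(\<lambda>z. if z = a then deriv g a else (g z - g a) / (z - a)) holomorphic_on UNIV"
    by (rule pole_lemma_open[OF assms(1)]) auto
  show "g z = (z - a) * (if z = a then deriv g a else (g z - g a) / (z - a))" for z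
    using assms(2) by auto
qed

lemma maximum_modulus_cball:
  assumes "g holomorphic_on UNIV" and "\<And>z. norm (z - c) = r \<Longrightarrow> norm (g z) \<le> M"
    and "norm (z - c) \<le> r" and "0 < r"
  shows "norm (g z) \<le> M"
proof (rule maximum_modulus_frontier[of g "cball c r"])
  show "g holomorphic_on interior (cball c r)" using assms(1) holomorphic_on_subset by blast
  show "continuous_on (closure (cball c r)) g"
    using assms(1) holomorphic_on_imp_continuous_on holomorphic_on_subset by blast
  show "norm (g z) \<le> M" if "z \<in> frontier (cball c r)" for z
    using that assms(2)[of z] assms(4) by (auto simp: dist_norm norm_minus_commute)
  show "z \<in> cball c r" using assms(3) by (simp add: dist_norm norm_minus_commute)
qed auto

text \<open>On the circle of radius \<open>4 * R\<close> each linear factor has modulus at least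
  \<open>3 * R\<close>, and the maximum principle carries the resulting bound for \<open>g\<close>
  inwards. At \<open>c\<close> a factor is at most \<open>R\<close>; this ratio of 3 per zero later
  bounds the number of zeros.\<close>

lemma cofactor_bound:
  assumes f: "f holomorphic_on UNIV" and g: "g holomorphic_on UNIV"
    and fac: "\<And>z. f z = (\<Prod>i<N. z - a i) * g z"
    and a: "\<And>i. i < N \<Longrightarrow> norm (a i - c) \<le> R" and R: "0 < R"
    and M: "\<And>z. norm (z - c) = 4 * R \<Longrightarrow> norm (f z) \<le> M"
    and z: "norm (z - c) \<le> 4 * R"
  shows "norm (g z) * (3 * R) ^ N \<le> M"
proof -
  have "norm (g z) \<le> M / (3 * R) ^ N"
  proof (rule maximum_modulus_cball[OF g _ z])
    fix w assume w: "norm (w - c) = 4 * R"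
    have "3 * R \<le> norm (w - a i)" if "i < N" for i
      using norm_triangle_ineq[of "w - a i" "a i - c"] w a[OF that] by simp
    then have "(\<Prod>i<N. 3 * R) \<le> (\<Prod>i<N. norm (w - a i))"
      using R by (intro prod_mono) auto
    then have "(3 * R) ^ N * norm (g w) \<le> (\<Prod>i<N. norm (w - a i)) * norm (g w)"
      by (intro mult_right_mono) auto
    also have "\<dots> = norm (f w)" by (simp add: fac norm_mult prod_norm)
    also have "\<dots> \<le> M" using M w by simp
    finally show "norm (g w) \<le> M / (3 * R) ^ N" using R by (simp add: field_simps)
  qed (use R in simp)
  then show ?thesis using R by (simp add: field_simps)
qed

text \<open>The zeros are split off one at a time; the maximum principle bounds their number, so the
  process stops.\<close>
lemma zero_factorization:
  assumes f: "f holomorphic_on UNIV" and c: "f c \<noteq> 0" and R: "0 < R"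
    and M: "\<And>z. norm (z - c) = 4 * R \<Longrightarrow> norm (f z) \<le> M"
  obtains N a g where "g holomorphic_on UNIV" and "\<And>z. f z = (\<Prod>i<N. z - a i) * g z"
    and "\<And>i. i < N \<Longrightarrow> norm (a i - c) \<le> R" and "\<And>z. norm (z - c) \<le> R \<Longrightarrow> g z \<noteq> 0"
    and "3 ^ N * norm (f c) \<le> M"
    and "\<And>z. norm (z - c) \<le> 4 * R \<Longrightarrow> norm (g z) * norm (f c) \<le> M * norm (g c)"
proof -
  define P where "P = (\<lambda>N::nat. \<exists>a g. g holomorphic_on UNIV \<and> (\<forall>z. f z = (\<Prod>i<N. z - a i) * g z) \<and>
    (\<forall>i<N. norm (a i - c) \<le> R))"
  have fc: "norm (f c) \<le> R ^ N * norm (g c)"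
    if "\<And>z. f z = (\<Prod>i<N. z - a i) * g z" "\<And>i. i < N \<Longrightarrow> norm (a i - c) \<le> R" for N a g
  proof -
    have "(\<Prod>i<N. norm (c - a i)) \<le> (\<Prod>i<N. R)"
      using that(2) by (intro prod_mono) (auto simp: norm_minus_commute)
    then show ?thesis by (simp add: that(1) norm_mult prod_norm mult_right_mono)
  qed
  have count: "3 ^ N * norm (f c) \<le> M"
    if "g holomorphic_on UNIV" "\<And>z. f z = (\<Prod>i<N. z - a i) * g z"
      "\<And>i. i < N \<Longrightarrow> norm (a i - c) \<le> R" for N a g
  proof -
    have "3 ^ N * norm (f c) \<le> 3 ^ N * (R ^ N * norm (g c))"
      using fc[OF that(2,3)] by (intro mult_left_mono) auto
    also have "\<dots> = norm (g c) * (3 * R) ^ N" by (simp add: power_mult_distrib)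
    also have "\<dots> \<le> M" by (rule cofactor_bound[OF f that R M]) (use R in auto)
    finally show ?thesis .
  qed
  have P0: "P 0" unfolding P_def using f by auto
  obtain b :: nat where b: "M / norm (f c) < 3 ^ b"
    using real_arch_pow[of 3 "M / norm (f c)"] by auto
  have bnd: "N \<le> b" if PN: "P N" for N
  proof -
    from PN obtain a g where ag: "g holomorphic_on UNIV" "\<And>z. f z = (\<Prod>i<N. z - a i) * g z"
      "\<And>i. i < N \<Longrightarrow> norm (a i - c) \<le> R" unfolding P_def by blast
    have "(3::real) ^ N < 3 ^ b"
    proof (rule le_less_trans[OF _ b])
      show "3 ^ N \<le> M / norm (f c)" using count[OF ag] c by (simp add: pos_le_divide_eq)
    qed
    then show ?thesis by (simp add: power_strict_increasing_iff)
  qed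
  define N where "N = (GREATEST N. P N)"
  have PN: "P N" unfolding N_def by (rule GreatestI_nat[of P 0 b]) (use P0 bnd in auto)
  have nP: "\<not> P (Suc N)"
    using Greatest_le_nat[of P "Suc N" b] bnd unfolding N_def[symmetric] by auto
  from PN obtain a g where ag: "g holomorphic_on UNIV" "\<And>z. f z = (\<Prod>i<N. z - a i) * g z"
      "\<And>i. i < N \<Longrightarrow> norm (a i - c) \<le> R" unfolding P_def by blast
  show thesis
  proof (rule that[OF ag])
    show "3 ^ N * norm (f c) \<le> M" by (rule count[OF ag])
    show "g z \<noteq> 0" if z: "norm (z - c) \<le> R" for z
    proof
      assume "g z = 0"
      then obtain g' where g': "g' holomorphic_on UNIV" "\<And>w. g w = (w - z) * g' w"
        using entire_divide_zero[OF ag(1)] by blast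
      have "f w = (\<Prod>i<Suc N. w - (a(N := z)) i) * g' w" for w
        by (simp add: ag(2) g'(2))
      moreover have "\<forall>i<Suc N. norm ((a(N := z)) i - c) \<le> R" using ag(3) z by auto
      ultimately have "P (Suc N)" unfolding P_def using g'(1) by blast
      with nP show False by simp
    qed
    show "norm (g z) * norm (f c) \<le> M * norm (g c)" if z: "norm (z - c) \<le> 4 * R" for z
    proof -
      have "norm (g z) * norm (f c) \<le> norm (g z) * (R ^ N * norm (g c))"
        using fc[OF ag(2,3)] by (intro mult_left_mono) auto
      also have "\<dots> = norm (g z) * R ^ N * norm (g c)" by simp
      also have "\<dots> \<le> norm (g z) * (3 * R) ^ N * norm (g c)"
        using R by (intro mult_right_mono mult_left_mono power_mono) auto
      also have "\<dots> \<le> M * norm (g c)"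
        by (intro mult_right_mono cofactor_bound[OF f ag R M z]) auto
      finally show ?thesis .
    qed
  qed
qed

subsection \<open>Derivatives along rays\<close>

text \<open>Rotation by \<open>- \<theta>'\<close> makes the second point real, so the imaginary
  part of the difference is \<open>t * sin (\<theta> - \<theta>')\<close> whatever \<open>t'\<close>
  is: the distance is measured to a whole line. The factor 1/2 comes from
  \<open>cos y \<ge> 1 / 2\<close> on \<open>[0, 1]\<close>.\<close>

lemma rcis_diff_ge:
  assumes "1 \<le> t" and "\<bar>\<theta> - \<theta>'\<bar> \<le> 1"
  shows "\<bar>\<theta> - \<theta>'\<bar> / 2 \<le> norm (rcis t \<theta> - rcis t' \<theta>')"
proof -
  have sin_half: "x / 2 \<le> sin x" if "0 \<le> x" "x \<le> 1" for x :: real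
  proof -
    have "sin 0 - 0 / 2 \<le> sin x - x / 2"
    proof (rule DERIV_nonneg_imp_nondecreasing[OF that(1)])
      fix y assume y: "0 \<le> y" "y \<le> x"
      have "cos (pi / 3) \<le> cos y"
        using y that pi_gt3 by (intro cos_monotone_0_pi_le) auto
      then show "\<exists>d. ((\<lambda>y. sin y - y / 2) has_real_derivative d) (at y) \<and> 0 \<le> d"
        by (intro exI[of _ "cos y - 1 / 2"]) (auto intro!: derivative_eq_intros simp: cos_60)
    qed
    then show ?thesis by simp
  qed
  have "\<bar>\<theta> - \<theta>'\<bar> / 2 \<le> \<bar>sin (\<theta> - \<theta>')\<bar>"
  proof (cases "\<theta>' \<le> \<theta>")
    case True
    then show ?thesis using sin_half[of "\<theta> - \<theta>'"] assms(2) by simp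
  next
    case False
    then show ?thesis using sin_half[of "\<theta>' - \<theta>"] assms(2) sin_minus[of "\<theta> - \<theta>'"] by simp
  qed
  also have "\<dots> \<le> t * \<bar>sin (\<theta> - \<theta>')\<bar>" using assms(1) by (simp add: mult_le_cancel_right1)
  also have "\<dots> = \<bar>Im ((rcis t \<theta> - rcis t' \<theta>') * cis (- \<theta>'))\<bar>"
    using assms(1) by (simp add: rcis_def left_diff_distrib mult.assoc cis_mult abs_mult)
  also have "\<dots> \<le> norm ((rcis t \<theta> - rcis t' \<theta>') * cis (- \<theta>'))" by (rule abs_Im_le_cmod)
  also have "\<dots> = norm (rcis t \<theta> - rcis t' \<theta>')" by (simp add: norm_mult)
  finally show ?thesis .
qed

text \<open>Pigeonhole: if each of \<open>N + 1\<close> rays came closer than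
  \<open>\<delta>\<close> to one of the \<open>N\<close> points, two of them would share a point and
  come within \<open>2 * \<delta>\<close> of each other, but rays whose angles differ by at least
  \<open>4 * \<delta>\<close> stay \<open>2 * \<delta>\<close> apart outside the unit disc.\<close>

lemma ray_avoiding_points:
  fixes a :: "nat \<Rightarrow> complex"
  assumes ab: "\<alpha> < \<beta>" "\<beta> \<le> \<alpha> + 1"
  obtains \<theta> where "\<alpha> < \<theta>" "\<theta> < \<beta>"
    "\<And>i t. i < N \<Longrightarrow> 1 \<le> t \<Longrightarrow> (\<beta> - \<alpha>) / (4 * (real N + 2)) \<le> norm (rcis t \<theta> - a i)"
proof -
  define \<delta> where "\<delta> = (\<beta> - \<alpha>) / (4 * (real N + 2))"
  \<comment> \<open>The \<open>N + 1\<close> interior division points of the interval cut into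
    \<open>N + 2\<close> parts of length \<open>4 * \<delta>\<close>.\<close>
  define s where "s = (\<lambda>j::nat. \<alpha> + 4 * \<delta> * (real j + 1))"
  have \<delta>: "0 < \<delta>" using ab by (simp add: \<delta>_def)
  have "4 * (e / (4 * n)) * n = e" if "0 < n" for e n :: real using that by simp
  from this[of "real N + 2" "\<beta> - \<alpha>"] have \<delta>': "4 * \<delta> * (real N + 2) = \<beta> - \<alpha>"
    unfolding \<delta>_def by linarith
  have s: "\<alpha> < s j" "s j < \<beta>" if "j \<le> N" for j
  proof -
    show "\<alpha> < s j" using \<delta> by (simp add: s_def)
    have "4 * \<delta> * (real j + 1) < 4 * \<delta> * (real N + 2)"
      using \<delta> that by (intro mult_strict_left_mono) auto
    then show "s j < \<beta>" using \<delta>' by (simp add: s_def)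
  qed
  have "\<exists>j\<le>N. \<forall>i t. i < N \<longrightarrow> 1 \<le> t \<longrightarrow> \<delta> \<le> norm (rcis t (s j) - a i)"
  proof (rule ccontr)
    assume "\<not> ?thesis"
    then have "\<forall>j\<in>{..N}. \<exists>i t. i < N \<and> 1 \<le> t \<and> norm (rcis t (s j) - a i) < \<delta>"
      by (meson atMost_iff not_le)
    then obtain i t where it: "\<And>j. j \<le> N \<Longrightarrow> i j < N \<and> 1 \<le> t j \<and> norm (rcis (t j) (s j) - a (i j)) < \<delta>"
      unfolding bchoice_iff by auto
    have "card (i ` {..N}) \<le> card {..<N}" using it by (intro card_mono) auto
    then have "\<not> inj_on i {..N}" by (intro pigeonhole) simp
    then obtain j k where jk: "j \<le> N" "k \<le> N" "j \<noteq> k" "i j = i k"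
      by (auto simp: inj_on_def)
    have "\<bar>s j - s k\<bar> \<le> 1" using s[OF jk(1)] s[OF jk(2)] ab by auto
    then have "\<bar>s j - s k\<bar> / 2 \<le> norm (rcis (t j) (s j) - rcis (t k) (s k))"
      using it[OF jk(1)] by (intro rcis_diff_ge) auto
    also have "\<dots> \<le> norm (rcis (t j) (s j) - a (i j)) + norm (rcis (t k) (s k) - a (i k))"
      using norm_triangle_ineq4[of "rcis (t j) (s j) - a (i j)" "rcis (t k) (s k) - a (i k)"] jk(4)
      by simp
    also have "\<dots> < 2 * \<delta>" using it[OF jk(1)] it[OF jk(2)] by simp
    finally have "\<bar>s j - s k\<bar> < 4 * \<delta>" by simp
    moreover have "s j - s k = 4 * \<delta> * (real j - real k)" by (simp add: s_def algebra_simps)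
    moreover have "1 \<le> \<bar>real j - real k\<bar>" using jk(3) by linarith
    then have "4 * \<delta> * 1 \<le> 4 * \<delta> * \<bar>real j - real k\<bar>" using \<delta> by (intro mult_left_mono) auto
    ultimately show False using \<delta> by (simp add: abs_mult)
  qed
  then show thesis using that s unfolding \<delta>_def by blast
qed

text \<open>Prepares Cauchy's inequality for the derivatives: near the ray \<open>f\<close> changes
  by a bounded factor on discs whose radius is of order \<open>1 / T^2\<close>. One factor
  \<open>exp 1\<close> is allowed for the zeros, which the ray avoids, and one for the zero-free
  cofactor \<open>g = exp h\<close>.\<close>

lemma ray_with_local_growth:
  assumes f: "f holomorphic_on UNIV" and c: "f c \<noteq> 0" and R: "2 \<le> R" and T: "0 \<le> T"
    and M: "\<And>z. norm (z - c) = 4 * R \<Longrightarrow> norm (f z) \<le> exp T * norm (f c)"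
    and ab: "\<alpha> < \<beta>" "\<beta> \<le> \<alpha> + 1"
  obtains \<theta> where "\<alpha> < \<theta>" "\<theta> < \<beta>"
    "\<And>t. 1 \<le> t \<Longrightarrow> norm (rcis t \<theta> - c) < R / 2 \<Longrightarrow> f (rcis t \<theta>) \<noteq> 0"
    "\<And>t w. 1 \<le> t \<Longrightarrow> norm (rcis t \<theta> - c) < R / 2 \<Longrightarrow>
      norm (w - rcis t \<theta>) \<le> (\<beta> - \<alpha>) / (48 * (T + 3)\<^sup>2) \<Longrightarrow> norm (f w) \<le> exp 2 * norm (f (rcis t \<theta>))"
proof -
  from R have R0: "0 < R" by simp
  obtain N a g where g: "g holomorphic_on UNIV" and fac: "\<And>z. f z = (\<Prod>i<N. z - a i) * g z"
    and a: "\<And>i. i < N \<Longrightarrow> norm (a i - c) \<le> R" and gnz: "\<And>z. norm (z - c) \<le> R \<Longrightarrow> g z \<noteq> 0"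
    and cnt: "3 ^ N * norm (f c) \<le> exp T * norm (f c)"
    and gb: "\<And>z. norm (z - c) \<le> 4 * R \<Longrightarrow> norm (g z) * norm (f c) \<le> exp T * norm (f c) * norm (g c)"
    by (rule zero_factorization[OF f c R0 M], assumption, rule that)
  have NT: "real N \<le> T"
  proof -
    have "exp (real N) = exp 1 ^ N" by (simp add: exp_of_nat_mult[symmetric])
    also have "\<dots> \<le> 3 ^ N" using exp_le by (intro power_mono) auto
    also have "\<dots> \<le> exp T" using cnt c by simp
    finally show ?thesis by simp
  qed
  obtain h where h: "h holomorphic_on ball c R" "\<And>z. z \<in> ball c R \<Longrightarrow> g z = exp (h z)"
    by (rule contractible_imp_holomorphic_log[of g "ball c R"])
      (use g gnz holomorphic_on_subset[OF g] convex_imp_contractible[OF convex_ball] in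
        \<open>auto simp: dist_norm norm_minus_commute\<close>)
  \<comment> \<open>The bound \<open>norm (g z) \<le> exp T * norm (g c)\<close> says
    \<open>Re (h z - h c) \<le> T\<close>, so \<open>H\<close> has positive real part, and
    \<open>H c = T + 1\<close>.\<close>
  define H where "H = (\<lambda>z. of_real (T + 1) - (h z - h c))"
  have H: "H holomorphic_on ball c R" unfolding H_def by (intro holomorphic_intros h)
  have Hpos: "0 < Re (H z)" if z: "z \<in> ball c R" for z
  proof -
    have "norm (g z) \<le> exp T * norm (g c)"
      using gb[of z] z c R0 by (simp add: dist_norm norm_minus_commute mult.commute mult.left_commute)
    then have "exp (Re (h z)) \<le> exp (T + Re (h c))"
      using h(2)[OF z] h(2)[of c] R0 by (simp add: norm_exp_eq_Re exp_add)
    then show ?thesis by (simp add: H_def)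
  qed
  \<comment> \<open>Two conditions fix this scale: \<open>12 * \<eta> * (T + 1) \<le> 1\<close>
    makes \<open>h\<close> vary by at most 1, and \<open>real N * \<eta> \<le> \<delta>\<close>
    makes the \<open>N\<close> linear factors together grow by at most \<open>exp 1\<close>. As
    \<open>\<delta>\<close> is itself of order \<open>1 / N\<close> and \<open>N \<le> T\<close>,
    the second one forces the square.\<close>
  define \<eta> where "\<eta> = (\<beta> - \<alpha>) / (48 * (T + 3)\<^sup>2)"
  define \<delta> where "\<delta> = (\<beta> - \<alpha>) / (4 * (real N + 2))"
  have \<delta>0: "0 < \<delta>" and \<eta>0: "0 < \<eta>" using ab T by (auto simp: \<delta>_def \<eta>_def)
  have \<eta>T: "12 * \<eta> * (T + 1) \<le> 1"
  proof -
    have "12 * \<eta> * (T + 1) = (\<beta> - \<alpha>) * (12 * (T + 1)) / (48 * (T + 3)\<^sup>2)"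
      by (simp add: \<eta>_def) (simp add: algebra_simps)
    also have "\<dots> \<le> 1 * (12 * (T + 1)) / (48 * (T + 3)\<^sup>2)"
      using ab T by (intro divide_right_mono mult_right_mono) auto
    also have "\<dots> \<le> 1"
    proof -
      have "0 < 48 * (T + 3)\<^sup>2" "0 \<le> T * T" using T by auto
      moreover have "12 * (T + 1) \<le> 48 * (T + 3)\<^sup>2"
        using T \<open>0 \<le> T * T\<close> unfolding power2_eq_square distrib_left distrib_right by linarith
      ultimately show ?thesis by (subst pos_divide_le_eq) auto
    qed
    finally show ?thesis .
  qed
  have \<eta>\<delta>: "real N * \<eta> \<le> \<delta>"
  proof -
    have "real N * (4 * (real N + 2)) \<le> T * (4 * (T + 2))"
      using NT by (intro mult_mono) auto
    also have "\<dots> \<le> 48 * (T + 3)\<^sup>2" using T by (simp add: power2_eq_square algebra_simps)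
    finally have "real N * (4 * (real N + 2)) \<le> 48 * (T + 3)\<^sup>2" .
    moreover have "x / Y \<le> 1 / X" if "x * X \<le> Y" "0 < X" "0 < Y" for x X Y :: real
      using that by (simp add: field_simps)
    moreover have "0 < 48 * (T + 3)\<^sup>2" "0 < 4 * (real N + 2)" using T by auto
    ultimately have "real N / (48 * (T + 3)\<^sup>2) \<le> 1 / (4 * (real N + 2))" by blast
    then have "(\<beta> - \<alpha>) * (real N / (48 * (T + 3)\<^sup>2)) \<le> (\<beta> - \<alpha>) * (1 / (4 * (real N + 2)))"
      using ab by (intro mult_left_mono) auto
    then show ?thesis unfolding \<eta>_def \<delta>_def by (simp add: mult.commute)
  qed
  have \<eta>half: "\<eta> \<le> 1 / 2"
  proof -
    have "12 * \<eta> * 1 \<le> 12 * \<eta> * (T + 1)" using T \<eta>0 by (intro mult_left_mono) auto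
    with \<eta>T show ?thesis by simp
  qed
  obtain \<theta> where \<theta>: "\<alpha> < \<theta>" "\<theta> < \<beta>"
    "\<And>i t. i < N \<Longrightarrow> 1 \<le> t \<Longrightarrow> \<delta> \<le> norm (rcis t \<theta> - a i)"
    using ray_avoiding_points[OF ab, of N a] unfolding \<delta>_def by blast
  show thesis
  proof (rule that[OF \<theta>(1,2)])
    fix t :: real assume t: "1 \<le> t" and zc: "norm (rcis t \<theta> - c) < R / 2"
    define z where "z = rcis t \<theta>"
    have d: "\<delta> \<le> norm (z - a i)" if "i < N" for i using \<theta>(3)[OF that t] by (simp add: z_def)
    have "z \<noteq> a i" if "i < N" for i using d[OF that] \<delta>0 by auto
    moreover have "g z \<noteq> 0" using gnz[of z] zc R0 by (simp add: z_def)
    ultimately show "f (rcis t \<theta>) \<noteq> 0" by (auto simp: fac z_def)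
    fix w assume "norm (w - rcis t \<theta>) \<le> (\<beta> - \<alpha>) / (48 * (T + 3)\<^sup>2)"
    then have w: "norm (w - z) \<le> \<eta>" by (simp add: z_def \<eta>_def)
    have zc': "norm (z - c) < R / 2" using zc by (simp add: z_def)
    \<comment> \<open>Harnack is used twice: from \<open>c\<close> to \<open>z\<close> to bound
      \<open>Re (H z)\<close>, then from \<open>z\<close> to \<open>w\<close> in the disc of radius
      \<open>R / 2\<close> about \<open>z\<close>, which still lies in
      \<open>ball c R\<close>.\<close>
    have "norm (H z - H c) \<le> 2 * (1 / 2) / (1 - 1 / 2) * Re (H c)"
      using zc' R0 by (intro holomorphic_positive_Re_bound[OF H Hpos]) auto
    then have "Re (H z) - Re (H c) \<le> 2 * Re (H c)"
      using complex_Re_le_cmod[of "H z - H c"] by simp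
    then have Hz: "Re (H z) \<le> 3 * (T + 1)" by (simp add: H_def)
    have sub: "ball z (R / 2) \<subseteq> ball c R"
      using zc' by (simp add: ball_subset_ball_iff dist_norm)
    have "norm (H w - H z) \<le> 2 * \<eta> / (1 - \<eta>) * Re (H z)"
    proof (rule holomorphic_positive_Re_bound[where h = H and r = "R / 2"])
      show "H holomorphic_on ball z (R / 2)" using H sub holomorphic_on_subset by blast
      have "\<eta> * 1 \<le> \<eta> * (R / 2)" using \<eta>0 R by (intro mult_left_mono) auto
      then show "norm (w - z) \<le> \<eta> * (R / 2)" using w by simp
    qed (use Hpos sub \<eta>half R0 in auto)
    also have "\<dots> \<le> 4 * \<eta> * (3 * (T + 1))"
    proof (rule mult_mono[OF _ Hz])
      have "2 * \<eta> \<le> 4 * \<eta> * (1 - \<eta>)"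
        using mult_left_mono[OF \<eta>half, of "\<eta>"] \<eta>0 by (simp add: algebra_simps)
      then show "2 * \<eta> / (1 - \<eta>) \<le> 4 * \<eta>" using \<eta>half by (simp add: pos_divide_le_eq)
      have "z \<in> ball c R" using zc' R0 by (simp add: dist_norm norm_minus_commute)
      then show "0 \<le> Re (H z)" using Hpos[of z] by simp
    qed (use \<eta>0 in auto)
    also have "\<dots> \<le> 1" using \<eta>T by (simp add: algebra_simps)
    finally have "norm (h w - h z) \<le> 1" by (simp add: H_def norm_minus_commute)
    then have hw: "Re (h w) \<le> 1 + Re (h z)"
      using complex_Re_le_cmod[of "h w - h z"] by simp
    have "norm (w - z) \<le> R / 2" using w \<eta>half R by simp
    then have wc: "norm (w - c) < R" using zc' norm_triangle_ineq[of "w - z" "z - c"] by simp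
    have gw: "norm (g w) \<le> exp 1 * norm (g z)"
      using hw h(2)[of w] h(2)[of z] wc zc' R0
      by (simp add: dist_norm norm_minus_commute norm_exp_eq_Re exp_add[symmetric])
    have "norm (w - a i) \<le> exp (\<eta> / \<delta>) * norm (z - a i)" if "i < N" for i
    proof -
      have "norm (w - a i) \<le> norm (z - a i) + \<eta> / \<delta> * \<delta>"
        using norm_triangle_ineq[of "w - z" "z - a i"] w \<delta>0 by simp
      also have "\<dots> \<le> norm (z - a i) + \<eta> / \<delta> * norm (z - a i)"
        using d[OF that] \<eta>0 \<delta>0 by (intro add_left_mono mult_left_mono) auto
      also have "\<dots> = (1 + \<eta> / \<delta>) * norm (z - a i)" by (simp add: algebra_simps)
      also have "\<dots> \<le> exp (\<eta> / \<delta>) * norm (z - a i)"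
        by (intro mult_right_mono exp_ge_add_one_self) auto
      finally show ?thesis .
    qed
    then have "(\<Prod>i<N. norm (w - a i)) \<le> (\<Prod>i<N. exp (\<eta> / \<delta>) * norm (z - a i))"
      by (intro prod_mono) auto
    also have "\<dots> = exp (real N * \<eta> / \<delta>) * (\<Prod>i<N. norm (z - a i))"
      by (simp add: prod.distrib exp_of_nat_mult[symmetric])
    also have "\<dots> \<le> exp 1 * (\<Prod>i<N. norm (z - a i))"
      using \<eta>\<delta> \<delta>0 by (intro mult_right_mono prod_nonneg) auto
    finally have "(\<Prod>i<N. norm (w - a i)) * norm (g w)
        \<le> (exp 1 * (\<Prod>i<N. norm (z - a i))) * (exp 1 * norm (g z))"
      using gw by (intro mult_mono mult_nonneg_nonneg prod_nonneg) auto
    also have "\<dots> = exp 1 * exp 1 * ((\<Prod>i<N. norm (z - a i)) * norm (g z))"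
      by (simp only: mult_ac)
    also have "exp 1 * exp 1 = exp (2::real)" by (simp flip: exp_add)
    finally show "norm (f w) \<le> exp 2 * norm (f (rcis t \<theta>))"
      unfolding z_def[symmetric] fac norm_mult prod_norm .
  qed
qed

text \<open>Finite order makes \<open>T\<close> at most a power of \<open>R\<close>, so Cauchy's
  inequality on discs of radius \<open>\<eta>\<close> about points of the ray loses only a power of
  \<open>R\<close>. The exponent \<open>K\<close> is independent of \<open>R\<close>; the direction
  is not.\<close>

lemma derivatives_bound_on_ray:
  assumes f: "f holomorphic_on UNIV" and c: "f c \<noteq> 0" and ab: "\<alpha> < \<beta>"
    and gr: "\<And>z. R1 \<le> norm z \<Longrightarrow> norm (f z) \<le> exp (norm z ^ q)"
  obtains K R0 where "\<And>R. R0 \<le> R \<Longrightarrow> \<exists>\<theta>. \<alpha> < \<theta> \<and> \<theta> < \<beta> \<and> (\<forall>t. 1 \<le> t \<and> t \<le> R \<longrightarrow>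
    f (rcis t \<theta>) \<noteq> 0 \<and> norm (deriv f (rcis t \<theta>)) \<le> R ^ K * norm (f (rcis t \<theta>)) \<and>
    norm (deriv (deriv f) (rcis t \<theta>)) \<le> R ^ K * norm (f (rcis t \<theta>)))"
proof -
  define \<beta>' where "\<beta>' = min \<beta> (\<alpha> + 1)"
  have ab': "\<alpha> < \<beta>'" "\<beta>' \<le> \<alpha> + 1" "\<beta>' \<le> \<beta>" using ab by (auto simp: \<beta>'_def)
  define L where "L = \<bar>ln (norm (f c))\<bar>"
  define C where "C = 2 * exp 2 * (48 / (\<beta>' - \<alpha>))\<^sup>2"
  \<comment> \<open>The discs have radius \<open>4 * R\<close>, hence growth is read off where
    \<open>norm (z - c) = 16 * R\<close>, so \<open>norm z\<close> is between \<open>15 * R\<close>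
    and \<open>17 * R\<close>. The entry 17 gives \<open>(17 * R) ^ q \<le> R ^ (2 * q)\<close>,
    \<open>L + 4\<close> then gives \<open>T + 3 \<le> R ^ (2 * q + 1)\<close>, and \<open>C\<close>
    absorbs the constant of the Cauchy estimate, leaving
    \<open>R * (R ^ (2 * q + 1)) ^ 4\<close>.\<close>
  define R0 where "R0 = Max {17, L + 4, C, R1, norm c + 1}"
  have R0: "17 \<le> R0" "L + 4 \<le> R0" "C \<le> R0" "R1 \<le> R0" "norm c + 1 \<le> R0"
    unfolding R0_def by (auto intro!: Max_ge)
  show thesis
  proof (rule that[of R0 "8 * q + 5"])
    fix R assume "R0 \<le> R"
    with R0 have R: "17 \<le> R" "L + 4 \<le> R" "C \<le> R" "R1 \<le> R" "norm c + 1 \<le> R" by auto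
    define T where "T = (17 * R) ^ q + L"
    have T0: "0 \<le> T" using R by (simp add: T_def L_def)
    have T3: "T + 3 \<le> R ^ (2 * q + 1)"
    proof -
      have "(17 * R) ^ q \<le> (R * R) ^ q" using R by (intro power_mono mult_right_mono) auto
      also have "\<dots> = R ^ (2 * q)" by (simp add: power_mult power2_eq_square)
      finally have 1: "(17 * R) ^ q \<le> R ^ (2 * q)" .
      have "1 \<le> R ^ (2 * q)" using R by (intro one_le_power) auto
      then have "(L + 3) * 1 \<le> (L + 3) * R ^ (2 * q)" by (intro mult_left_mono) (auto simp: L_def)
      with 1 have "T + 3 \<le> (L + 4) * R ^ (2 * q)" by (simp add: T_def algebra_simps)
      also have "\<dots> \<le> R * R ^ (2 * q)" using R by (intro mult_right_mono) auto
      finally show ?thesis by simp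
    qed
    have M: "norm (f z) \<le> exp T * norm (f c)" if z: "norm (z - c) = 4 * (4 * R)" for z
    proof -
      have "15 * R \<le> norm z" using z R norm_triangle_ineq4[of z c] by simp
      moreover have "norm z \<le> 17 * R" using z R norm_triangle_ineq[of "z - c" c] by simp
      ultimately have "norm (f z) \<le> exp (norm z ^ q)" "norm z ^ q \<le> (17 * R) ^ q"
        using gr[of z] R by (simp, intro power_mono) auto
      then have "norm (f z) \<le> exp ((17 * R) ^ q) * 1" by (smt (verit) exp_le_cancel_iff)
      also have "1 \<le> exp L * norm (f c)"
      proof -
        have "exp 0 \<le> exp (L + ln (norm (f c)))" unfolding exp_le_cancel_iff by (simp add: L_def)
        then show ?thesis using c by (simp add: exp_add)
      qed
      finally show ?thesis by (simp add: T_def exp_add mult.assoc)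
    qed
    define \<eta> where "\<eta> = (\<beta>' - \<alpha>) / (48 * (T + 3)\<^sup>2)"
    have \<eta>0: "0 < \<eta>" using ab' T0 by (simp add: \<eta>_def)
    have D: "2 * exp 2 / \<eta>\<^sup>2 \<le> R ^ (8 * q + 5)"
    proof -
      have "2 * E / (b / (48 * S\<^sup>2))\<^sup>2 = 2 * E * (48 / b)\<^sup>2 * S ^ 4" if "0 < b" "0 < S" for b E S :: real
        using that by (simp add: field_simps power2_eq_square power4_eq_xxxx)
      then have "2 * exp 2 / \<eta>\<^sup>2 = C * (T + 3) ^ 4"
        using ab' T0 by (simp only: \<eta>_def C_def)
      also have "\<dots> \<le> R * (R ^ (2 * q + 1)) ^ 4"
        using R T3 T0 by (intro mult_mono power_mono) auto
      also have "\<dots> = R ^ (8 * q + 5)" by (simp add: power_mult[symmetric] power_Suc[symmetric] add.commute del: power_Suc)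
      finally show ?thesis .
    qed
    have \<eta>1: "\<eta> \<le> 1"
    proof -
      have "1 \<le> (T + 3)\<^sup>2" using T0 by (simp add: power2_eq_square algebra_simps)
      then have "\<beta>' - \<alpha> \<le> 48 * (T + 3)\<^sup>2" using ab' by linarith
      then show ?thesis using T0 by (simp add: \<eta>_def)
    qed
    have R4: "2 \<le> 4 * R" using R by simp
    obtain \<theta> where \<theta>: "\<alpha> < \<theta>" "\<theta> < \<beta>'"
      "\<And>t. 1 \<le> t \<Longrightarrow> norm (rcis t \<theta> - c) < 4 * R / 2 \<Longrightarrow> f (rcis t \<theta>) \<noteq> 0"
      "\<And>t w. 1 \<le> t \<Longrightarrow> norm (rcis t \<theta> - c) < 4 * R / 2 \<Longrightarrow>
        norm (w - rcis t \<theta>) \<le> \<eta> \<Longrightarrow> norm (f w) \<le> exp 2 * norm (f (rcis t \<theta>))"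
      by (rule ray_with_local_growth[OF f c R4 T0 M ab'(1,2), folded \<eta>_def], assumption, rule that)
    have "f z \<noteq> 0 \<and> norm (deriv f z) \<le> R ^ (8 * q + 5) * norm (f z) \<and>
          norm (deriv (deriv f) z) \<le> R ^ (8 * q + 5) * norm (f z)"
      if t: "1 \<le> t" "t \<le> R" and z: "z = rcis t \<theta>" for t z
    proof -
      have "norm z \<le> R" using t z by simp
      then have "norm (z - c) < 4 * R / 2" using R norm_triangle_ineq4[of z c] by simp
      note * = this[unfolded z]
      have C: "norm ((deriv ^^ n) f z) \<le> fact n * (exp 2 * norm (f z)) / \<eta> ^ n" for n
        using \<theta>(4)[OF t(1) *] \<eta>0 unfolding z
        by (intro Cauchy_inequality holomorphic_on_subset[OF f]
            continuous_on_subset[OF holomorphic_on_imp_continuous_on[OF f]])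
          (auto simp: norm_minus_commute)
      have "norm (deriv f z) \<le> exp 2 * norm (f z) / \<eta>" using C[of 1] by simp
      also have "\<dots> \<le> 2 * exp 2 / \<eta>\<^sup>2 * norm (f z)"
      proof -
        have "1 / \<eta> \<le> 2 / \<eta>\<^sup>2" using \<eta>0 \<eta>1 by (simp add: field_simps power2_eq_square)
        from mult_left_mono[OF this, of "exp 2 * norm (f z)"] show ?thesis
          by (simp add: mult.commute mult.left_commute)
      qed
      finally have 1: "norm (deriv f z) \<le> 2 * exp 2 / \<eta>\<^sup>2 * norm (f z)" .
      have 2: "norm (deriv (deriv f) z) \<le> 2 * exp 2 / \<eta>\<^sup>2 * norm (f z)"
        using C[of 2] by (simp add: numeral_2_eq_2)
      show ?thesis
        using \<theta>(3)[OF t(1) *] order_trans[OF 1 mult_right_mono[OF D]]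
          order_trans[OF 2 mult_right_mono[OF D]] z by simp
    qed
    with \<theta>(1,2) ab'(3) show "\<exists>\<theta>. \<alpha> < \<theta> \<and> \<theta> < \<beta> \<and> (\<forall>t. 1 \<le> t \<and> t \<le> R \<longrightarrow>
      f (rcis t \<theta>) \<noteq> 0 \<and> norm (deriv f (rcis t \<theta>)) \<le> R ^ (8 * q + 5) * norm (f (rcis t \<theta>)) \<and>
      norm (deriv (deriv f) (rcis t \<theta>)) \<le> R ^ (8 * q + 5) * norm (f (rcis t \<theta>)))"
      by (intro exI[of _ \<theta>]) auto
  qed
qed

subsection \<open>Iterates on compact subsets of the Fatou set\<close>

text \<open>The two outcomes of normality are recorded as uniform escape and, in the next
  definition, as an eventual uniform bound in place of convergence. Neither mentions a limit
  function, so outcomes on overlapping sets can be compared at a common point.\<close>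

definition escapes_on :: "complex set \<Rightarrow> (nat \<Rightarrow> complex \<Rightarrow> complex) \<Rightarrow> bool" where
  "escapes_on V s \<longleftrightarrow> (\<forall>C. \<forall>\<^sub>F n in sequentially. \<forall>z\<in>V. C \<le> norm (s n z))"

definition bounded_along :: "complex set \<Rightarrow> (nat \<Rightarrow> complex \<Rightarrow> complex) \<Rightarrow> bool" where
  "bounded_along V s \<longleftrightarrow> (\<exists>C. \<forall>\<^sub>F n in sequentially. \<forall>z\<in>V. norm (s n z) \<le> C)"

lemma escapes_on_subseq: "escapes_on V s \<Longrightarrow> strict_mono r \<Longrightarrow> escapes_on V (s \<circ> r)"
  unfolding escapes_on_def by (auto dest: eventually_subseq)

lemma bounded_along_subseq: "bounded_along V s \<Longrightarrow> strict_mono r \<Longrightarrow> bounded_along V (s \<circ> r)"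
  unfolding bounded_along_def by (auto dest!: eventually_subseq)

lemma escapes_not_bounded:
  assumes "escapes_on V s" "bounded_along W s" "V \<inter> W \<noteq> {}"
  shows False
proof -
  obtain C where "\<forall>\<^sub>F n in sequentially. \<forall>z\<in>W. norm (s n z) \<le> C"
    using assms(2) unfolding bounded_along_def by blast
  moreover have "\<forall>\<^sub>F n in sequentially. \<forall>z\<in>V. C + 1 \<le> norm (s n z)"
    using assms(1) unfolding escapes_on_def by blast
  ultimately have "\<forall>\<^sub>F n in sequentially. False"
  proof eventually_elim
    case (elim n)
    obtain z where "z \<in> V" "z \<in> W" using assms(3) by blast
    then have "norm (s n z) \<le> C" "C + 1 \<le> norm (s n z)" using elim by blast+
    then show False by simp
  qed
  then show False by simp
qed

lemma normal_family_dichotomy: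
  assumes norm: "normal_family_on U F" and K: "compact K" "K \<subseteq> U" and s: "range s \<subseteq> F"
    and cont: "\<And>h. h \<in> F \<Longrightarrow> continuous_on K h"
  obtains r :: "nat \<Rightarrow> nat" where "strict_mono r" "bounded_along K (s \<circ> r) \<or> escapes_on K (s \<circ> r)"
proof -
  obtain r :: "nat \<Rightarrow> nat" where r: "strict_mono r" and
    alt: "(\<exists>g. \<forall>K. compact K \<and> K \<subseteq> U \<longrightarrow> uniform_limit K (s \<circ> r) g sequentially) \<or>
            (\<forall>K. compact K \<and> K \<subseteq> U \<longrightarrow>
               (\<forall>C. \<forall>\<^sub>F n in sequentially. \<forall>z\<in>K. C \<le> norm (s (r n) z)))"
    using norm s unfolding normal_family_on_def by meson
  from alt have "bounded_along K (s \<circ> r) \<or> escapes_on K (s \<circ> r)"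
  proof
    assume "\<exists>g. \<forall>K. compact K \<and> K \<subseteq> U \<longrightarrow> uniform_limit K (s \<circ> r) g sequentially"
    then obtain g where "uniform_limit K (s \<circ> r) g sequentially" using K by blast
    then have ev: "\<forall>\<^sub>F n in sequentially. \<forall>z\<in>K. dist ((s \<circ> r) n z) (g z) < 1"
      unfolding uniform_limit_iff by simp
    \<comment> \<open>The limit is compared with a single member of the sequence, whose boundedness
      on \<open>K\<close> follows from its continuity.\<close>
    then obtain N where N: "\<forall>z\<in>K. dist ((s \<circ> r) N z) (g z) < 1"
      unfolding eventually_sequentially by blast
    have "(s \<circ> r) N \<in> F" using s by auto
    then have "compact ((s \<circ> r) N ` K)" using cont K by (intro compact_continuous_image) auto
    then have "bounded ((s \<circ> r) N ` K)" by (rule compact_imp_bounded)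
    then obtain C where C: "\<And>z. z \<in> K \<Longrightarrow> norm ((s \<circ> r) N z) \<le> C" unfolding bounded_iff by auto
    have "\<forall>\<^sub>F n in sequentially. \<forall>z\<in>K. norm ((s \<circ> r) n z) \<le> C + 2"
      using ev
    proof eventually_elim
      case (elim n)
      show ?case
      proof
        fix z assume z: "z \<in> K"
        have "dist ((s \<circ> r) n z) (g z) < 1" "dist ((s \<circ> r) N z) (g z) < 1" using z elim N by auto
        then have "dist ((s \<circ> r) n z) ((s \<circ> r) N z) < 2"
          using dist_triangle2[of "(s \<circ> r) n z" "(s \<circ> r) N z" "g z"] by simp
        then show "norm ((s \<circ> r) n z) \<le> C + 2"
          using C[OF z] norm_triangle_sub[of "(s \<circ> r) n z" "(s \<circ> r) N z"] by (simp add: dist_norm)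
      qed
    qed
    then show ?thesis unfolding bounded_along_def by blast
  next
    assume "\<forall>K. compact K \<and> K \<subseteq> U \<longrightarrow>
               (\<forall>C. \<forall>\<^sub>F n in sequentially. \<forall>z\<in>K. C \<le> norm (s (r n) z))"
    then have "escapes_on K (s \<circ> r)" using K unfolding escapes_on_def by simp
    then show ?thesis ..
  qed
  with r show thesis by (rule that)
qed

lemma holomorphic_on_funpow:
  assumes B: "B holomorphic_on UNIV"
  shows "(B ^^ n) holomorphic_on UNIV"
proof (induction n)
  case (Suc n)
  then show ?case
    using holomorphic_on_compose[OF Suc holomorphic_on_subset[OF B]] by (simp add: o_def)
qed (simp add: holomorphic_on_id)

text \<open>Finitely many closed balls, each inside a domain of normality, cover \<open>V\<close>;
  successive extraction gives one subsequence that is bounded or escapes on each of them.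
  Overlapping balls cannot behave differently, so the two kinds separate \<open>V\<close>, and
  connectedness leaves only one kind.\<close>

lemma Fatou_compact_dichotomy:
  fixes B :: "complex \<Rightarrow> complex"
  assumes B: "B holomorphic_on UNIV" and V: "compact V" "connected V" "V \<subseteq> Fatou_set B"
    and s: "range s \<subseteq> {B ^^ n | n. 1 \<le> n}"
  obtains r :: "nat \<Rightarrow> nat" where "strict_mono r" "bounded_along V (s \<circ> r) \<or> escapes_on V (s \<circ> r)"
proof -
  define F where "F = {B ^^ n | n. 1 \<le> n}"
  have cont: "continuous_on K h" if "h \<in> F" for h K
    using that holomorphic_on_imp_continuous_on[OF holomorphic_on_funpow[OF B]] continuous_on_subset
    unfolding F_def by blast
  have sF: "range s \<subseteq> F" using s by (simp add: F_def)
  have "\<exists>U e. 0 < e \<and> cball x e \<subseteq> U \<and> normal_family_on U F" if "x \<in> V" for x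
  proof -
    obtain U where U: "open U" "x \<in> U" "normal_family_on U F"
      using V(3) \<open>x \<in> V\<close> unfolding Fatou_set_def F_def by blast
    then obtain e where "0 < e" "cball x e \<subseteq> U" using open_contains_cball by blast
    then show ?thesis using U by blast
  qed
  then obtain U e where Ue: "\<And>x. x \<in> V \<Longrightarrow> 0 < e x \<and> cball x (e x) \<subseteq> U x \<and> normal_family_on (U x) F"
    by metis
  obtain D where D: "D \<subseteq> V" "finite D" "V \<subseteq> (\<Union>x\<in>D. ball x (e x))"
    by (rule compactE_image[OF V(1), of V "\<lambda>x. ball x (e x)"]) (use Ue in force)+
  have "\<exists>r::nat \<Rightarrow> nat. strict_mono r \<and>
      (\<forall>x\<in>E. bounded_along (cball x (e x)) (s \<circ> r) \<or> escapes_on (cball x (e x)) (s \<circ> r))"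
    if "finite E" "E \<subseteq> V" for E
    using that
  proof (induction E rule: finite_induct)
    case empty
    then show ?case by (auto intro: strict_mono_id)
  next
    case (insert x E)
    then obtain r :: "nat \<Rightarrow> nat" where r: "strict_mono r"
      "\<And>x. x \<in> E \<Longrightarrow> bounded_along (cball x (e x)) (s \<circ> r) \<or> escapes_on (cball x (e x)) (s \<circ> r)"
      by (meson insert_subset)
    have x: "x \<in> V" using insert by auto
    have rng: "range (s \<circ> r) \<subseteq> F" using sF by auto
    obtain q :: "nat \<Rightarrow> nat" where q: "strict_mono q"
      "bounded_along (cball x (e x)) (s \<circ> r \<circ> q) \<or> escapes_on (cball x (e x)) (s \<circ> r \<circ> q)"
      using normal_family_dichotomy[of "U x" F "cball x (e x)" "s \<circ> r", OF _ compact_cball _ rng cont]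
        Ue[OF x] by metis
    have "strict_mono (r \<circ> q)" using r(1) q(1) by (rule strict_mono_o)
    moreover have "\<forall>y\<in>insert x E. bounded_along (cball y (e y)) (s \<circ> (r \<circ> q)) \<or>
        escapes_on (cball y (e y)) (s \<circ> (r \<circ> q))"
    proof
      fix y assume "y \<in> insert x E"
      then consider "y = x" | "y \<in> E" by blast
      then show "bounded_along (cball y (e y)) (s \<circ> (r \<circ> q)) \<or> escapes_on (cball y (e y)) (s \<circ> (r \<circ> q))"
      proof cases
        case 1
        then show ?thesis using q(2) by (simp add: comp_assoc)
      next
        case 2
        from r(2)[OF this] show ?thesis
          using bounded_along_subseq[OF _ q(1)] escapes_on_subseq[OF _ q(1)]
          by (metis comp_assoc)
      qed
    qed
    ultimately show ?case by blast
  qed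
  then obtain r :: "nat \<Rightarrow> nat" where r: "strict_mono r"
    "\<And>x. x \<in> D \<Longrightarrow> bounded_along (cball x (e x)) (s \<circ> r) \<or> escapes_on (cball x (e x)) (s \<circ> r)"
    using D by meson
  define t where "t = s \<circ> r"
  define D1 where "D1 = {x \<in> D. bounded_along (cball x (e x)) t}"
  define D2 where "D2 = {x \<in> D. escapes_on (cball x (e x)) t}"
  define E1 where "E1 = (\<Union>x\<in>D1. ball x (e x))"
  define E2 where "E2 = (\<Union>x\<in>D2. ball x (e x))"
  have fin: "finite D1" "finite D2" using D(2) by (auto simp: D1_def D2_def)
  have "V \<subseteq> E1 \<union> E2" using D(3) r(2) unfolding E1_def E2_def D1_def D2_def t_def by blast
  moreover have "open E1" "open E2" by (auto simp: E1_def E2_def)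
  moreover have "E1 \<inter> E2 \<inter> V = {}"
  proof -
    have False if xy: "x \<in> D1" "y \<in> D2" "z \<in> ball x (e x)" "z \<in> ball y (e y)" for x y z
    proof (rule escapes_not_bounded)
      show "escapes_on (cball y (e y)) t" "bounded_along (cball x (e x)) t"
        using xy by (auto simp: D1_def D2_def)
      show "cball y (e y) \<inter> cball x (e x) \<noteq> {}" using xy(3,4) ball_subset_cball by blast
    qed
    then show ?thesis unfolding E1_def E2_def by blast
  qed
  ultimately have "E1 \<inter> V = {} \<or> E2 \<inter> V = {}" using connectedD[OF V(2)] by blast
  then have "V \<subseteq> E2 \<or> V \<subseteq> E1" using \<open>V \<subseteq> E1 \<union> E2\<close> by blast
  then have "escapes_on V t \<or> bounded_along V t"
  proof
    assume V2: "V \<subseteq> E2"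
    have "escapes_on V t" unfolding escapes_on_def
    proof
      fix C
      have "\<forall>\<^sub>F n in sequentially. \<forall>x\<in>D2. \<forall>z\<in>cball x (e x). C \<le> norm (t n z)"
        by (rule eventually_ball_finite[OF fin(2)]) (auto simp: D2_def escapes_on_def)
      then show "\<forall>\<^sub>F n in sequentially. \<forall>z\<in>V. C \<le> norm (t n z)"
      proof eventually_elim
        case (elim n)
        then show ?case using V2 ball_subset_cball unfolding E2_def by blast
      qed
    qed
    then show ?thesis ..
  next
    assume V1: "V \<subseteq> E1"
    have "\<forall>x\<in>D1. \<exists>C. \<forall>\<^sub>F n in sequentially. \<forall>z\<in>cball x (e x). norm (t n z) \<le> C"
      by (auto simp: D1_def bounded_along_def)
    from bchoice[OF this] obtain C where C: "\<forall>x\<in>D1. \<forall>\<^sub>F n in sequentially. \<forall>z\<in>cball x (e x). norm (t n z) \<le> C x"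
      ..
    have "\<forall>\<^sub>F n in sequentially. \<forall>x\<in>D1. \<forall>z\<in>cball x (e x). norm (t n z) \<le> C x"
      by (rule eventually_ball_finite[OF fin(1) C])
    then have "\<forall>\<^sub>F n in sequentially. \<forall>z\<in>V. norm (t n z) \<le> (\<Sum>x\<in>D1. \<bar>C x\<bar>)"
    proof eventually_elim
      case (elim n)
      show ?case
      proof
        fix z assume "z \<in> V"
        then obtain x where x: "x \<in> D1" "z \<in> cball x (e x)"
          using V1 ball_subset_cball unfolding E1_def by blast
        then have "norm (t n z) \<le> \<bar>C x\<bar>" using elim by fastforce
        also have "\<dots> \<le> (\<Sum>x\<in>D1. \<bar>C x\<bar>)" using x fin by (intro member_le_sum) auto
        finally show "norm (t n z) \<le> (\<Sum>x\<in>D1. \<bar>C x\<bar>)" .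
      qed
    qed
    then show ?thesis unfolding bounded_along_def by blast
  qed
  then show thesis using that[OF r(1)] unfolding t_def by blast
qed

section \<open>Harnack chains along a curve, and growth of transcendental functions\<close>

text \<open>The real part of a logarithm of \<open>g\<close> is positive, hence at most triples at
  half the radius; exponentiation turns the factor 3 into an exponent.\<close>

lemma Harnack_norm:
  assumes g: "g holomorphic_on ball a r" and big: "\<And>z. z \<in> ball a r \<Longrightarrow> 1 < norm (g z)"
    and z: "norm (z - a) \<le> r / 2" and r: "0 < r"
  shows "norm (g z) \<le> norm (g a) ^ 3"
proof -
  have nz: "g z \<noteq> 0" if "z \<in> ball a r" for z using big[OF that] by auto
  obtain h where h: "h holomorphic_on ball a r" "\<And>z. z \<in> ball a r \<Longrightarrow> g z = exp (h z)"
    by (rule contractible_imp_holomorphic_log[OF g convex_imp_contractible[OF convex_ball] nz],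
        assumption, rule that)
  have pos: "0 < Re (h z)" if "z \<in> ball a r" for z
    using big[OF that] h(2)[OF that] by (simp add: norm_exp_eq_Re)
  have "norm (h z - h a) \<le> 2 * (1 / 2) / (1 - 1 / 2) * Re (h a)"
    by (rule holomorphic_positive_Re_bound[OF h(1) pos]) (use z r in auto)
  then have "Re (h z) \<le> 3 * Re (h a)" using complex_Re_le_cmod[of "h z - h a"] by simp
  then have "exp (Re (h z)) \<le> exp (3 * Re (h a))" by simp
  also have "\<dots> = exp (Re (h a)) ^ 3" by (simp add: exp_of_nat_mult[symmetric])
  finally show ?thesis
    using h(2)[of z] h(2)[of a] z r by (simp add: norm_exp_eq_Re dist_norm norm_minus_commute)
qed

text \<open>The number of Harnack steps depends only on the modulus of continuity of
  \<open>\<gamma>\<close> and on \<open>r\<close>. That \<open>C\<close> precedes \<open>g\<close>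
  is the point: a single exponent serves all iterates.\<close>

lemma Harnack_path:
  assumes \<gamma>: "path \<gamma>" and r: "0 < r"
  obtains C :: nat where "1 \<le> C"
    "\<And>g x y. g holomorphic_on UNIV \<Longrightarrow> \<forall>u\<in>path_image \<gamma>. \<forall>z\<in>ball u r. 1 < norm (g z)
      \<Longrightarrow> x \<in> path_image \<gamma> \<Longrightarrow> y \<in> path_image \<gamma> \<Longrightarrow> norm (g x) \<le> norm (g y) ^ C"
proof -
  have "uniformly_continuous_on {0..1} \<gamma>"
    using \<gamma> unfolding path_def by (intro compact_uniformly_continuous) auto
  then obtain d where d: "0 < d"
    "\<And>a b. a \<in> {0..1} \<Longrightarrow> b \<in> {0..1} \<Longrightarrow> dist b a < d \<Longrightarrow> dist (\<gamma> b) (\<gamma> a) < r / 2"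
    unfolding uniformly_continuous_on_def using r by (metis half_gt_zero)
  obtain n :: nat where n: "n \<noteq> 0" "1 / real n < d"
    using real_arch_inverse[of d] d(1) by (auto simp: inverse_eq_divide)
  show thesis
  proof (rule that[of "3 ^ n"])
    show "(1::nat) \<le> 3 ^ n" by simp
  next
    fix g x y
    assume g: "g holomorphic_on UNIV"
      and big: "\<forall>u\<in>path_image \<gamma>. \<forall>z\<in>ball u r. 1 < norm (g z)"
      and x: "x \<in> path_image \<gamma>" and y: "y \<in> path_image \<gamma>"
    obtain s t where s: "s \<in> {0..1}" "x = \<gamma> s" and t: "t \<in> {0..1}" "y = \<gamma> t"
      using x y unfolding path_image_def by blast
    \<comment> \<open>The parameter interval between \<open>s\<close> and \<open>t\<close> is cut
      into \<open>n\<close> steps of length at most \<open>1 / n < d\<close>, wherever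
      \<open>s\<close> and \<open>t\<close> lie.\<close>
    define p where "p = (\<lambda>i::nat. s + (t - s) * (real i / n))"
    have p: "p i \<in> {0..1}" if "i \<le> n" for i
    proof -
      have "real i / n \<le> 1" "0 \<le> real i / n" using that n by auto
      then have "(1 - real i / n) * s + (real i / n) * t \<in> {0..1}"
        using convexD_alt[of "{0..1::real}" s t "real i / n"] s t by (simp add: convex_real_interval)
      moreover have "s + (t - s) * q = (1 - q) * s + q * t" for q by (simp add: algebra_simps)
      ultimately show ?thesis unfolding p_def by metis
    qed
    have step: "norm (g (\<gamma> (p i))) \<le> norm (g (\<gamma> (p (Suc i)))) ^ 3" if "Suc i \<le> n" for i
    proof -
      have "p (Suc i) - p i = (t - s) * (1 / n)" 
      proof -
        have "real (Suc i) / n = real i / n + 1 / n" by (simp add: add_divide_distrib)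
        then show ?thesis unfolding p_def by (simp only: distrib_left)
      qed
      then have "\<bar>p (Suc i) - p i\<bar> = \<bar>t - s\<bar> * (1 / n)" by (simp add: abs_mult)
      also have "\<dots> \<le> 1 * (1 / n)" using s t by (intro mult_right_mono) auto
      finally have "dist (p i) (p (Suc i)) < d" using n(2) by (simp add: dist_real_def)
      then have "dist (\<gamma> (p i)) (\<gamma> (p (Suc i))) < r / 2"
        using p that by (intro d(2)) auto
      then show ?thesis
      proof (intro Harnack_norm[of g "\<gamma> (p (Suc i))" r, OF holomorphic_on_subset[OF g]])
        show "1 < norm (g z)" if "z \<in> ball (\<gamma> (p (Suc i))) r" for z
          using big that p[OF \<open>Suc i \<le> n\<close>] unfolding path_image_def by blast
      qed (use r in \<open>auto simp: dist_norm\<close>)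
    qed
    have "norm (g (\<gamma> (p 0))) \<le> norm (g (\<gamma> (p i))) ^ (3 ^ i)" if "i \<le> n" for i
      using that
    proof (induction i)
      case (Suc i)
      then have "norm (g (\<gamma> (p 0))) \<le> norm (g (\<gamma> (p i))) ^ (3 ^ i)" by simp
      also have "\<dots> \<le> (norm (g (\<gamma> (p (Suc i)))) ^ 3) ^ (3 ^ i)"
        using step[OF Suc.prems] by (intro power_mono) auto
      finally show ?case by (simp add: power_mult[symmetric] mult.commute)
    qed simp
    from this[of n] show "norm (g x) \<le> norm (g y) ^ (3 ^ n)" using n s t by (simp add: p_def)
  qed
qed

text \<open>Some Taylor coefficient of index \<open>j > k\<close> is nonzero, since otherwise the
  power series would be a polynomial; Cauchy's inequality for this coefficient forbids growth below
  \<open>m ^ k\<close>.\<close>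

lemma transcendental_growth:
  assumes "transcendental_entire B"
  obtains R where "\<And>m. R \<le> m \<Longrightarrow> \<exists>w. norm w < m \<and> m ^ k \<le> norm (B w)"
proof -
  have B: "B holomorphic_on UNIV" and np: "\<And>q. \<exists>z. B z \<noteq> poly q z"
    using assms unfolding transcendental_entire_def by auto
  have "\<exists>j>k. (deriv ^^ j) B 0 \<noteq> 0"
  proof (rule ccontr)
    assume "\<not> ?thesis"
    then have z: "\<And>j. k < j \<Longrightarrow> (deriv ^^ j) B 0 = 0" by blast
    define q where "q = (\<Sum>j\<le>k. monom ((deriv ^^ j) B 0 / fact j) j)"
    have "B w = poly q w" for w
    proof -
      have "(\<lambda>n. (deriv ^^ n) B 0 / fact n * (w - 0) ^ n) sums B w"
        by (rule holomorphic_power_series[where r = "norm w + 1"])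
          (auto intro: holomorphic_on_subset[OF B])
      moreover have "(\<lambda>n. (deriv ^^ n) B 0 / fact n * (w - 0) ^ n) sums
          (\<Sum>n\<le>k. (deriv ^^ n) B 0 / fact n * (w - 0) ^ n)"
        by (rule sums_finite) (auto simp: z)
      ultimately show ?thesis by (simp add: q_def poly_sum poly_monom sums_unique2)
    qed
    with np show False by blast
  qed
  then obtain j where j: "k < j" "(deriv ^^ j) B 0 \<noteq> 0" by blast
  define a where "a = norm ((deriv ^^ j) B 0)"
  have a: "0 < a" using j by (simp add: a_def)
  show thesis
  \<comment> \<open>If \<open>norm (B w) \<le> m ^ k\<close> for all \<open>norm w < m\<close>,
    Cauchy's inequality at radius \<open>m / 2\<close> would give
    \<open>a * m \<le> fact j * 2 ^ j\<close>.\<close>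
  proof (rule that[of "max 1 (fact j * 2 ^ j / a + 1)"])
    fix m assume "max 1 (fact j * 2 ^ j / a + 1) \<le> m"
    then have m: "1 \<le> m" "fact j * 2 ^ j / a < m" by auto
    show "\<exists>w. norm w < m \<and> m ^ k \<le> norm (B w)"
    proof (rule ccontr)
      assume "\<not> ?thesis"
      then have le: "\<And>w. norm w < m \<Longrightarrow> norm (B w) \<le> m ^ k" by force
      have "a \<le> fact j * m ^ k / (m / 2) ^ j"
        unfolding a_def
        by (rule Cauchy_inequality[OF holomorphic_on_subset[OF B]
              continuous_on_subset[OF holomorphic_on_imp_continuous_on[OF B]]])
          (use m le in auto)
      also have "\<dots> = fact j * 2 ^ j * (m ^ k / m ^ j)" by (simp add: power_divide)
      also have "\<dots> \<le> fact j * 2 ^ j * (1 / m)"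
      proof (rule mult_left_mono)
        have "m ^ k * m \<le> m ^ j" using j m power_increasing[of "Suc k" j m] by (simp add: mult.commute)
        then show "m ^ k / m ^ j \<le> 1 / m" using m by (simp add: field_simps)
      qed simp
      finally show False using m a by (simp add: field_simps)
    qed
  qed
qed

lemma frontier_image_subset:
  assumes g: "g holomorphic_on UNIV" "\<not> g constant_on UNIV" and W: "open W" "bounded W"
  shows "frontier (g ` W) \<subseteq> g ` frontier W"
proof -
  have "open (g ` W)" by (rule open_mapping_thm[OF g(1) _ _ W(1) _ g(2)]) auto
  moreover have "compact (g ` closure W)"
    using W(2) holomorphic_on_imp_continuous_on[OF g(1)]
    by (intro compact_continuous_image) (auto intro: continuous_on_subset)
  then have "closure (g ` W) \<subseteq> g ` closure W"
    by (intro closure_minimal image_mono closure_subset compact_imp_closed)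
  ultimately show ?thesis
    unfolding frontier_def using W(1) by (auto simp: interior_open)
qed

section \<open>Curves around points of the Julia set and their images under iterates\<close>

lemma open_Fatou_set: "open (Fatou_set B)"
proof (subst open_subopen, intro ballI)
  fix z assume "z \<in> Fatou_set B"
  then obtain U where U: "open U" "connected U" "z \<in> U" "normal_family_on U {B ^^ n | n. 1 \<le> n}"
    unfolding Fatou_set_def by blast
  then have "U \<subseteq> Fatou_set B" unfolding Fatou_set_def by blast
  with U show "\<exists>T. open T \<and> z \<in> T \<and> T \<subseteq> Fatou_set B" by blast
qed

text \<open>A curve winding around a point \<open>z\<close> outside \<open>U\<close> exists, but
  \<open>z\<close> may belong to another Fatou component. If the whole inside were in the Fatou set,
  curve and inside would form a connected subset meeting \<open>U\<close>, and maximality of the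
  component would put \<open>z\<close> into \<open>U\<close>.\<close>

lemma Fatou_multiply_connected_curve:
  assumes U: "U \<in> components (Fatou_set B)" "\<not> simply_connected U"
  obtains \<gamma> j where "path \<gamma>" "path_image \<gamma> \<subseteq> U" "j \<in> inside (path_image \<gamma>)" "j \<notin> Fatou_set B"
proof -
  have "open U" using open_components[OF open_Fatou_set U(1)] .
  then obtain \<gamma> z where \<gamma>: "path \<gamma>" "path_image \<gamma> \<subseteq> U" "pathfinish \<gamma> = pathstart \<gamma>"
    and z: "z \<notin> U" "winding_number \<gamma> z \<noteq> 0"
    using U simply_connected_eq_winding_number_zero[of U] in_components_connected by blast
  have zi: "z \<in> inside (path_image \<gamma>)"
    using winding_number_zero_in_outside[OF \<gamma>(1,3)] z \<gamma>(2) inside_Un_outside[of "path_image \<gamma>"]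
    by blast
  have "\<not> inside (path_image \<gamma>) \<subseteq> Fatou_set B"
  proof
    assume sub: "inside (path_image \<gamma>) \<subseteq> Fatou_set B"
    have "path_image \<gamma> \<union> inside (path_image \<gamma>) \<subseteq> U"
    proof (rule components_maximal[OF U(1)])
      show "connected (path_image \<gamma> \<union> inside (path_image \<gamma>))"
        using \<gamma>(1) by (intro connected_with_inside closed_path_image connected_path_image)
      show "path_image \<gamma> \<union> inside (path_image \<gamma>) \<subseteq> Fatou_set B"
        using sub \<gamma>(2) in_components_subset[OF U(1)] by blast
      show "U \<inter> (path_image \<gamma> \<union> inside (path_image \<gamma>)) \<noteq> {}"
        using \<gamma>(2) path_image_nonempty[of \<gamma>] by blast
    qed
    with zi z show False by blast
  qed
  with \<gamma> that show thesis by blast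
qed

text \<open>The minimum principle: a sequence that is large on the boundary curve and has no zeros
  inside would converge to infinity there.\<close>
lemma escapes_inside:
  assumes hol: "\<And>n. s n holomorphic_on UNIV" and W: "open W" "bounded W"
    and esc: "escapes_on (frontier W) s" and nz: "\<And>n z. z \<in> W \<Longrightarrow> s n z \<noteq> 0"
  shows "escapes_on W s"
  unfolding escapes_on_def
proof
  fix C :: real
  define C' where "C' = max 1 C"
  have "\<forall>\<^sub>F n in sequentially. \<forall>z\<in>frontier W. C' \<le> norm (s n z)"
    using esc unfolding escapes_on_def by blast
  then show "\<forall>\<^sub>F n in sequentially. \<forall>z\<in>W. C \<le> norm (s n z)"
  proof eventually_elim
    case (elim n)
    have nzc: "s n z \<noteq> 0" if "z \<in> closure W" for z
      using nz[of z n] elim that W(1) unfolding closure_Un_frontier C'_def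
      by (smt (verit) Un_iff norm_zero)
    show ?case
    proof
      fix z assume z: "z \<in> W"
      have "norm (inverse (s n z)) \<le> 1 / C'"
      proof (rule maximum_modulus_frontier[of "\<lambda>z. inverse (s n z)" W, OF _ _ W(2) _ z])
        show "(\<lambda>z. inverse (s n z)) holomorphic_on interior W"
          using nz interior_subset by (intro holomorphic_intros holomorphic_on_subset[OF hol]) auto
        show "continuous_on (closure W) (\<lambda>z. inverse (s n z))"
          using nzc continuous_on_subset[OF holomorphic_on_imp_continuous_on[OF hol]]
          by (intro continuous_intros) auto
        show "norm (inverse (s n z)) \<le> 1 / C'" if "z \<in> frontier W" for z
        proof -
          have "C' \<le> norm (s n z)" "0 < C'" using elim that by (auto simp: C'_def)
          then show ?thesis using le_imp_inverse_le[of C' "norm (s n z)"]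
            by (simp add: norm_inverse inverse_eq_divide norm_divide)
        qed
      qed
      then have "inverse (norm (s n z)) \<le> inverse C'"
        by (simp only: norm_inverse inverse_eq_divide[of C'])
      then have "C' \<le> norm (s n z)"
        by (rule inverse_le_imp_le) (use nz[OF z, of n] in simp)
      then show "C \<le> norm (s n z)" by (simp add: C'_def)
    qed
  qed
qed

lemma bounded_along_inside:
  assumes hol: "\<And>n. s n holomorphic_on UNIV" and W: "open W" "bounded W"
    and bd: "bounded_along (frontier W) s"
  shows "bounded_along W s"
proof -
  obtain C where "\<forall>\<^sub>F n in sequentially. \<forall>z\<in>frontier W. norm (s n z) \<le> C"
    using bd unfolding bounded_along_def by blast
  then have "\<forall>\<^sub>F n in sequentially. \<forall>z\<in>W. norm (s n z) \<le> C"
  proof eventually_elim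
    case (elim n)
    show ?case
    proof
      fix z assume z: "z \<in> W"
      show "norm (s n z) \<le> C"
        by (rule maximum_modulus_frontier[of "s n" W, OF holomorphic_on_subset[OF hol]
              continuous_on_subset[OF holomorphic_on_imp_continuous_on[OF hol]] W(2) _ z])
          (use elim in auto)
    qed
  qed
  then show ?thesis unfolding bounded_along_def by blast
qed

lemma bounded_along_normal:
  assumes hol: "\<And>n. s n holomorphic_on UNIV" and S: "open S" and bd: "bounded_along S s"
  obtains g r where "strict_mono (r :: nat \<Rightarrow> nat)"
    "\<And>K. compact K \<Longrightarrow> K \<subseteq> S \<Longrightarrow> uniform_limit K (s \<circ> r) g sequentially"
proof -
  obtain C N where C: "\<And>n z. N \<le> n \<Longrightarrow> z \<in> S \<Longrightarrow> norm (s n z) \<le> C"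
    using bd unfolding bounded_along_def eventually_sequentially by blast
  define F where "F = range (\<lambda>n. s (n + N))"
  obtain g r where "strict_mono (r :: nat \<Rightarrow> nat)"
    "\<And>K. compact K \<Longrightarrow> K \<subseteq> S \<Longrightarrow> uniform_limit K ((\<lambda>n. s (n + N)) \<circ> r) g sequentially"
    by (rule Montel[OF S, of F "\<lambda>n. s (n + N)"])
      (use C in \<open>auto simp: F_def intro!: holomorphic_on_subset[OF hol] exI[of _ C]\<close>)
  then show thesis
    using that[of "\<lambda>n. r n + N" g] by (auto simp: strict_mono_def o_def)
qed

lemma image_covers:
  assumes g: "g holomorphic_on UNIV" and W: "open W" "bounded W" and z0: "z0 \<in> W" "g z0 = 0"
    and m: "0 < m" "\<And>z. z \<in> frontier W \<Longrightarrow> m \<le> norm (g z)"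
  shows "ball 0 m \<subseteq> g ` W" and "\<exists>t z. 0 \<le> t \<and> z \<in> frontier W \<and> g z = rcis t \<theta>"
proof -
  have "W \<noteq> UNIV" using W(2) not_bounded_UNIV by blast
  then obtain z1 where z1: "z1 \<in> frontier W"
    using z0 frontier_eq_empty[of W] by blast
  have "\<not> g constant_on UNIV"
    using m(1) m(2)[OF z1] z0(2) unfolding constant_on_def by (metis UNIV_I norm_zero not_le)
  note fr = frontier_image_subset[OF g this W]
  have 0: "0 \<in> g ` W" using z0 by force
  show "ball 0 m \<subseteq> g ` W"
  proof (rule ccontr)
    assume "\<not> ball 0 m \<subseteq> g ` W"
    moreover have "ball 0 m \<inter> g ` W \<noteq> {}" using 0 m(1) by (metis centre_in_ball disjoint_iff)
    ultimately have "ball 0 m \<inter> frontier (g ` W) \<noteq> {}"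
      by (intro connected_Int_frontier) auto
    then obtain z where "z \<in> frontier W" "norm (g z) < m" using fr by (auto simp: disjoint_iff)
    then show False using m(2) by force
  qed
  define L where "L = (\<lambda>t. rcis t \<theta>) ` {0..}"
  have "continuous_on {0..} (\<lambda>t. rcis t \<theta>)" unfolding rcis_def by (intro continuous_intros)
  then have "connected L" unfolding L_def
    by (intro connected_continuous_image) (auto intro: convex_connected)
  moreover have "L \<inter> g ` W \<noteq> {}" using 0 unfolding L_def by (force simp: rcis_def)
  moreover have "L - g ` W \<noteq> {}"
  proof
    assume "L - g ` W = {}"
    then have "L \<subseteq> g ` closure W" using closure_subset by blast
    moreover have "compact (g ` closure W)"
      using W(2) holomorphic_on_imp_continuous_on[OF g]
      by (intro compact_continuous_image) (auto intro: continuous_on_subset)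
    ultimately have "bounded L" using compact_imp_bounded bounded_subset by blast
    then obtain b where b: "\<And>x. x \<in> L \<Longrightarrow> norm x \<le> b" unfolding bounded_iff by blast
    have "rcis (\<bar>b\<bar> + 1) \<theta> \<in> L" unfolding L_def by auto
    from b[OF this] show False by simp
  qed
  ultimately have "L \<inter> frontier (g ` W) \<noteq> {}" by (rule connected_Int_frontier)
  then show "\<exists>t z. 0 \<le> t \<and> z \<in> frontier W \<and> g z = rcis t \<theta>"
    using fr unfolding L_def by force
qed

lemma power_le_of_power_le:
  fixes a b :: real
  assumes "a ^ n \<le> b ^ n" "0 \<le> b" "1 \<le> n"
  shows "a \<le> b"
  using assms power_strict_mono[of b a n] by force

text \<open>The iterates \<open>s\<close> are chosen non-normal near a point \<open>j\<close> inside
  the curve. A bound on the curve is excluded by the maximum principle and Montel's theorem, so a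
  subsequence escapes there; were its members free of zeros in \<open>W\<close>, it would escape
  near \<open>j\<close> as well. So late members vanish in \<open>W\<close>, and their images of the
  curve surround discs. The exponent \<open>C\<close> is obtained before \<open>K\<close> and
  \<open>R\<close>.\<close>

lemma large_on_rays:
  assumes tr: "transcendental_entire B"
    and U: "U \<in> components (Fatou_set B)" "\<not> simply_connected U"
  obtains C :: nat where "\<And>K R. \<exists>m\<ge>R. \<forall>\<theta>. \<exists>t. m \<le> t \<and> t \<le> m ^ C \<and> m ^ K \<le> norm (B (rcis t \<theta>))"
proof -
  have B: "B holomorphic_on UNIV" using tr unfolding transcendental_entire_def by auto
  obtain \<gamma> j where \<gamma>: "path \<gamma>" "path_image \<gamma> \<subseteq> U" and j: "j \<in> inside (path_image \<gamma>)" "j \<notin> Fatou_set B"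
    using Fatou_multiply_connected_curve[OF U] .
  define \<Gamma> where "\<Gamma> = path_image \<gamma>"
  define W where "W = inside \<Gamma>"
  have \<Gamma>: "compact \<Gamma>" "connected \<Gamma>" "\<Gamma> \<noteq> {}" "closed \<Gamma>" "bounded \<Gamma>"
    using \<gamma>(1) compact_path_image connected_path_image path_image_nonempty closed_path_image
      bounded_path_image unfolding \<Gamma>_def by blast+
  have W: "open W" "bounded W" "frontier W \<subseteq> \<Gamma>" "j \<in> W"
    using \<Gamma> j open_inside bounded_inside frontier_inside_subset unfolding W_def \<Gamma>_def by blast+
  define F where "F = {B ^^ n | n. 1 \<le> n}"
  have hol: "h holomorphic_on UNIV" if "h \<in> F" for h
    using that holomorphic_on_funpow[OF B] unfolding F_def by blast
  obtain e where e: "0 < e" "ball j e \<subseteq> W" using W(1,4) open_contains_ball by blast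
  have "\<not> normal_family_on (ball j e) F"
    using j(2) e(1) unfolding Fatou_set_def F_def by (metis (mono_tags, lifting) CollectI centre_in_ball connected_ball open_ball)
  then obtain s where s: "range s \<subseteq> F" and
    nolim: "\<And>r g. strict_mono (r :: nat \<Rightarrow> nat) \<Longrightarrow>
      \<not> (\<forall>K. compact K \<and> K \<subseteq> ball j e \<longrightarrow> uniform_limit K (s \<circ> r) g sequentially)" and
    noinf: "\<And>r. strict_mono (r :: nat \<Rightarrow> nat) \<Longrightarrow>
      \<not> (\<forall>K. compact K \<and> K \<subseteq> ball j e \<longrightarrow>
               (\<forall>C. \<forall>\<^sub>F n in sequentially. \<forall>z\<in>K. C \<le> norm (s (r n) z)))"
    unfolding normal_family_on_def by blast
  have not_bounded: "\<not> bounded_along \<Gamma> (s \<circ> r)" if r: "strict_mono r" for r :: "nat \<Rightarrow> nat"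
  proof
    assume "bounded_along \<Gamma> (s \<circ> r)"
    then have bW: "bounded_along (frontier W) (s \<circ> r)"
      using W(3) unfolding bounded_along_def by (blast intro: eventually_mono)
    have "bounded_along W (s \<circ> r)"
      by (rule bounded_along_inside[OF _ W(1,2) bW]) (use hol s in auto)
    then have "bounded_along (ball j e) (s \<circ> r)"
      using e(2) unfolding bounded_along_def by (blast intro: eventually_mono)
    then obtain g q where q: "strict_mono (q :: nat \<Rightarrow> nat)"
      "\<And>K. compact K \<Longrightarrow> K \<subseteq> ball j e \<Longrightarrow> uniform_limit K (s \<circ> r \<circ> q) g sequentially"
      using bounded_along_normal[of "s \<circ> r" "ball j e"] hol s by (metis comp_apply open_ball range_subsetD)
    then show False
      using nolim[of "r \<circ> q" g] strict_mono_o[OF r q(1)] by (simp add: comp_assoc)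
  qed
  have not_escaping: "\<not> escapes_on W (s \<circ> r)" if r: "strict_mono r" for r :: "nat \<Rightarrow> nat"
  proof
    assume "escapes_on W (s \<circ> r)"
    then have "\<forall>K C. K \<subseteq> ball j e \<longrightarrow> (\<forall>\<^sub>F n in sequentially. \<forall>z\<in>K. C \<le> norm (s (r n) z))"
      using e(2) unfolding escapes_on_def o_def by (blast intro: eventually_mono)
    then show False using noinf[OF r] by blast
  qed
  have "\<Gamma> \<subseteq> Fatou_set B" using \<gamma>(2) in_components_subset[OF U(1)] by (auto simp: \<Gamma>_def)
  then obtain \<delta> where \<delta>: "0 < \<delta>" "(\<Union>x\<in>\<Gamma>. cball x \<delta>) \<subseteq> Fatou_set B"
    using compact_subset_open_imp_cball_epsilon_subset[OF \<Gamma>(1) open_Fatou_set] by blast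
  \<comment> \<open>A closed \<open>\<delta>\<close>-neighbourhood of the curve, written as the
    image of a product so that compactness and connectedness are inherited from the factors; the
    Harnack discs need this margin.\<close>
  define V where "V = (\<lambda>(x, y). x + y) ` (\<Gamma> \<times> cball (0::complex) \<delta>)"
  have contV: "continuous_on (\<Gamma> \<times> cball (0::complex) \<delta>) (\<lambda>(x, y). x + y)"
    by (auto simp: case_prod_unfold intro!: continuous_intros)
  have V_eq: "V = (\<Union>x\<in>\<Gamma>. cball x \<delta>)"
  proof -
    have "z \<in> V" if "x \<in> \<Gamma>" "dist x z \<le> \<delta>" for x z
      unfolding V_def using that by (intro image_eqI[of _ _ "(x, z - x)"]) (auto simp: dist_norm norm_minus_commute)
    then show ?thesis by (auto simp: V_def dist_norm)
  qed
  have "compact (\<Gamma> \<times> cball (0::complex) \<delta>)" "connected (\<Gamma> \<times> cball (0::complex) \<delta>)"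
    using \<Gamma> by (auto intro!: compact_Times connected_Times)
  then have V: "compact V" "connected V" "V \<subseteq> Fatou_set B"
    using compact_continuous_image[OF contV] connected_continuous_image[OF contV] \<delta>(2) V_eq
    unfolding V_def by auto
  have \<Gamma>V: "\<Gamma> \<subseteq> V" using \<delta>(1) unfolding V_eq by force
  obtain C :: nat where C: "1 \<le> C"
    "\<And>g x y. g holomorphic_on UNIV \<Longrightarrow> \<forall>u\<in>\<Gamma>. \<forall>z\<in>ball u \<delta>. 1 < norm (g z)
      \<Longrightarrow> x \<in> \<Gamma> \<Longrightarrow> y \<in> \<Gamma> \<Longrightarrow> norm (g x) \<le> norm (g y) ^ C"
    by (rule Harnack_path[OF \<gamma>(1) \<delta>(1), folded \<Gamma>_def], rule that)
  have Harnack: "norm (g x) \<le> norm (g y) ^ C"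
    if "g \<in> F" "\<And>z. z \<in> V \<Longrightarrow> 2 \<le> norm (g z)" "x \<in> \<Gamma>" "y \<in> \<Gamma>" for g x y
  proof (rule C(2)[of g x y])
    show "\<forall>u\<in>\<Gamma>. \<forall>z\<in>ball u \<delta>. 1 < norm (g z)"
    proof (intro ballI)
      fix u z assume "u \<in> \<Gamma>" "z \<in> ball u \<delta>"
      then have "z \<in> V" unfolding V_eq by force
      then show "1 < norm (g z)" using that(2)[of z] by simp
    qed
  qed (use that hol in auto)
  obtain r :: "nat \<Rightarrow> nat" where r: "strict_mono r" "bounded_along V (s \<circ> r) \<or> escapes_on V (s \<circ> r)"
    using Fatou_compact_dichotomy[OF B V] s unfolding F_def by blast
  moreover have "\<not> bounded_along V (s \<circ> r)"
    using not_bounded[OF r(1)] \<Gamma>V unfolding bounded_along_def by (blast intro: eventually_mono)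
  ultimately have esc: "escapes_on V (s \<circ> r)" by blast
  have zero: "\<forall>\<^sub>F n in sequentially. \<exists>z\<in>W. (s \<circ> r) n z = 0"
  proof (rule ccontr)
    assume "\<not> ?thesis"
    then obtain q :: "nat \<Rightarrow> nat" where q: "strict_mono q" "\<And>n z. z \<in> W \<Longrightarrow> (s \<circ> r \<circ> q) n z \<noteq> 0"
      using not_eventually_sequentiallyD by fastforce
    have eW: "escapes_on (frontier W) (s \<circ> r \<circ> q)"
      using escapes_on_subseq[OF esc q(1)] W(3) \<Gamma>V unfolding escapes_on_def
      by (blast intro: eventually_mono)
    have "escapes_on W (s \<circ> r \<circ> q)"
      by (rule escapes_inside[OF _ W(1,2) eW]) (use hol s q(2) in auto)
    then show False using not_escaping[of "r \<circ> q"] strict_mono_o[OF r(1) q(1)] by (simp add: comp_assoc)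
  qed
  \<comment> \<open>Composing with \<open>B\<close> gives iterates again, so the dichotomy and
    Harnack's inequality with the same \<open>C\<close> also apply to the values of \<open>B\<close>
    on the image curve.\<close>
  define u where "u = (\<lambda>n. B \<circ> (s \<circ> r) n)"
  have uF: "range u \<subseteq> F"
  proof -
    have "B \<circ> h \<in> F" if hF: "h \<in> F" for h
    proof -
      obtain n where "h = B ^^ n" "1 \<le> n" using hF unfolding F_def by blast
      then have "B \<circ> h = B ^^ Suc n" by (simp add: o_def fun_eq_iff)
      then show ?thesis unfolding F_def by force
    qed
    then show ?thesis using s unfolding u_def by auto
  qed
  obtain q :: "nat \<Rightarrow> nat" where q: "strict_mono q" "bounded_along V (u \<circ> q) \<or> escapes_on V (u \<circ> q)"
    using Fatou_compact_dichotomy[OF B V] uF unfolding F_def by blast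
  define t where "t = s \<circ> r \<circ> q"
  have t: "escapes_on V t" "\<forall>\<^sub>F n in sequentially. \<exists>z\<in>W. t n z = 0" "\<And>n. t n \<in> F"
    using escapes_on_subseq[OF esc q(1)] eventually_subseq[OF q(1) zero] s
    unfolding t_def by auto
  have uq: "(u \<circ> q) n z = B (t n z)" for n z by (simp add: u_def t_def)
  \<comment> \<open>The image of \<open>W\<close> covers the disc of radius \<open>m\<close>, so
    \<open>w = t n x\<close> with \<open>x\<close> in \<open>W\<close>; the maximum principle for
    \<open>B\<close> composed with \<open>t n\<close> moves from \<open>x\<close> to the
    curve.\<close>
  have surround: "\<exists>y\<in>\<Gamma>. norm (B w) \<le> norm (B (t n y))"
    if n: "\<exists>z\<in>W. t n z = 0" and m: "\<And>y. y \<in> \<Gamma> \<Longrightarrow> m \<le> norm (t n y)" and w: "norm w < m" for n m w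
  proof -
    have tn: "t n holomorphic_on UNIV" using hol t(3) by blast
    then have Bt: "(\<lambda>z. B (t n z)) holomorphic_on UNIV"
      using holomorphic_on_compose[OF tn holomorphic_on_subset[OF B]] by (simp add: o_def)
    have cont: "continuous_on \<Gamma> (\<lambda>z. norm (B (t n z)))"
      using continuous_on_subset[OF holomorphic_on_imp_continuous_on[OF Bt]] by (intro continuous_on_norm) auto
    obtain y where y: "y \<in> \<Gamma>" "\<And>x. x \<in> \<Gamma> \<Longrightarrow> norm (B (t n x)) \<le> norm (B (t n y))"
      using continuous_attains_sup[OF \<Gamma>(1,3) cont] by blast
    obtain z0 where z0: "z0 \<in> W" "t n z0 = 0" using n by blast
    have "0 < m" using w norm_ge_zero[of w] by linarith
    then have "ball 0 m \<subseteq> t n ` W" using m W(3) by (intro image_covers(1)[OF tn W(1,2) z0]) auto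
    then obtain x where x: "x \<in> W" "w = t n x" using w by force
    have "norm (B (t n x)) \<le> norm (B (t n y))"
      by (rule maximum_modulus_frontier[of "\<lambda>z. B (t n z)" W, OF holomorphic_on_subset[OF Bt]
            continuous_on_subset[OF holomorphic_on_imp_continuous_on[OF Bt]] W(2) _ x(1)])
        (use y(2) W(3) in auto)
    then show ?thesis using x y(1) by blast
  qed
  \<comment> \<open>The image curves surround arbitrarily large discs, so a bound for
    \<open>B\<close> on them would bound \<open>B\<close> on the plane, against Liouville's
    theorem.\<close>
  have "\<not> bounded_along V (u \<circ> q)"
  proof
    assume "bounded_along V (u \<circ> q)"
    then obtain c where c: "\<forall>\<^sub>F n in sequentially. \<forall>z\<in>V. norm (B (t n z)) \<le> c"
      unfolding bounded_along_def uq by blast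
    have Bc: "norm (B w) \<le> c" for w
    proof -
      have "\<forall>\<^sub>F n in sequentially. \<forall>z\<in>V. norm w + 1 \<le> norm (t n z)"
        using t(1) unfolding escapes_on_def by blast
      with c t(2) have "\<forall>\<^sub>F n in sequentially. norm (B w) \<le> c"
      proof eventually_elim
        case (elim n)
        obtain y where "y \<in> \<Gamma>" "norm (B w) \<le> norm (B (t n y))"
          using surround[OF elim(2), of "norm w + 1" w] elim(3) \<Gamma>V by auto
        then show ?case using elim(1) \<Gamma>V by force
      qed
      then show ?thesis by simp
    qed
    then have "bounded (range B)" unfolding bounded_iff by blast
    then obtain b where "\<And>z. B z = b"
      using Liouville_theorem[OF B] unfolding constant_on_def by blast
    then have "\<forall>z. B z = poly [:b:] z" by simp
    then show False using tr unfolding transcendental_entire_def by blast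
  qed
  with q(2) have escu: "escapes_on V (u \<circ> q)" by blast
  show thesis
  proof (rule that)
    fix K R
    \<comment> \<open>The exponent carries the factor \<open>C\<close> because passing from the best
      point \<open>y0\<close> of the curve to an arbitrary one costs a \<open>C\<close>-th
      root.\<close>
    obtain R' where R': "\<And>m. R' \<le> m \<Longrightarrow> \<exists>w. norm w < m \<and> m ^ (K * C) \<le> norm (B w)"
      using transcendental_growth[OF tr, of "K * C"] by blast
    define R2 where "R2 = max 2 (max R R')"
    have "\<forall>\<^sub>F n in sequentially. \<forall>z\<in>V. R2 \<le> norm (t n z)"
      "\<forall>\<^sub>F n in sequentially. \<forall>z\<in>V. 2 \<le> norm ((u \<circ> q) n z)"
      using t(1) escu unfolding escapes_on_def by blast+
    with t(2) have "\<forall>\<^sub>F n in sequentially. (\<exists>z\<in>W. t n z = 0) \<and> (\<forall>z\<in>V. R2 \<le> norm (t n z)) \<and>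
        (\<forall>z\<in>V. 2 \<le> norm ((u \<circ> q) n z))"
      by eventually_elim blast
    then obtain n where n: "\<exists>z\<in>W. t n z = 0" "\<And>z. z \<in> V \<Longrightarrow> R2 \<le> norm (t n z)"
        "\<And>z. z \<in> V \<Longrightarrow> 2 \<le> norm ((u \<circ> q) n z)"
      unfolding eventually_sequentially by blast
    have tn: "t n holomorphic_on UNIV" using hol t(3) by blast
    have cont: "continuous_on \<Gamma> (\<lambda>z. norm (t n z))"
      using continuous_on_subset[OF holomorphic_on_imp_continuous_on[OF tn]] by (intro continuous_on_norm) auto
    obtain x0 where x0: "x0 \<in> \<Gamma>" "\<And>x. x \<in> \<Gamma> \<Longrightarrow> norm (t n x0) \<le> norm (t n x)"
      using continuous_attains_inf[OF \<Gamma>(1,3) cont] by blast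
    define m where "m = norm (t n x0)"
    have mR: "2 \<le> m" "R \<le> m" "R' \<le> m" using n(2)[of x0] x0(1) \<Gamma>V by (auto simp: m_def R2_def)
    obtain w where w: "norm w < m" "m ^ (K * C) \<le> norm (B w)" using R' mR by blast
    obtain y0 where y0: "y0 \<in> \<Gamma>" "norm (B w) \<le> norm (B (t n y0))"
      using surround[OF n(1) _ w(1)] x0(2) by (auto simp: m_def)
    have large: "m ^ K \<le> norm (B (t n y))" if y: "y \<in> \<Gamma>" for y
    proof (rule power_le_of_power_le[OF _ norm_ge_zero C(1)])
      have "(m ^ K) ^ C \<le> norm ((u \<circ> q) n y0)" using w(2) y0(2) unfolding uq by (simp add: power_mult)
      also have "\<dots> \<le> norm ((u \<circ> q) n y) ^ C"
        by (rule Harnack[of "(u \<circ> q) n" y0 y]) (use uF n(3) y0(1) y in auto)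
      finally show "(m ^ K) ^ C \<le> norm (B (t n y)) ^ C" unfolding uq .
    qed
    have upper: "norm (t n y) \<le> m ^ C" if "y \<in> \<Gamma>" for y
      unfolding m_def
      by (rule Harnack[of "t n" y x0]) (use n(2) t(3) that x0(1) in \<open>auto simp: R2_def\<close>)
    obtain z0 where z0: "z0 \<in> W" "t n z0 = 0" using n(1) by blast
    have "\<exists>\<tau>. m \<le> \<tau> \<and> \<tau> \<le> m ^ C \<and> m ^ K \<le> norm (B (rcis \<tau> \<theta>))" for \<theta>
    proof -
      have "\<exists>\<tau> z. 0 \<le> \<tau> \<and> z \<in> frontier W \<and> t n z = rcis \<tau> \<theta>"
        by (rule image_covers(2)[OF tn W(1,2) z0, of m]) (use mR x0(2) W(3) in \<open>auto simp: m_def\<close>)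
      then obtain \<tau> z where \<tau>: "0 \<le> \<tau>" "z \<in> \<Gamma>" "t n z = rcis \<tau> \<theta>" using W(3) by blast
      then have "norm (t n z) = \<tau>" by simp
      then show ?thesis using large[OF \<tau>(2)] upper[OF \<tau>(2)] x0(2)[OF \<tau>(2)] \<tau>(3)
        unfolding m_def by metis
    qed
    with mR show "\<exists>m\<ge>R. \<forall>\<theta>. \<exists>t. m \<le> t \<and> t \<le> m ^ C \<and> m ^ K \<le> norm (B (rcis t \<theta>))" by blast
  qed
qed

subsection \<open>Canonical products\<close>

lemma has_prod_norm_le_exp:
  fixes f :: "nat \<Rightarrow> complex"
  assumes "f has_prod P" and "\<And>i. norm (f i) \<le> exp (c i)" and "\<And>n. N \<le> n \<Longrightarrow> (\<Sum>i\<le>n. c i) \<le> X"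
  shows "norm P \<le> exp X"
proof (rule LIMSEQ_le_const2)
  show "(\<lambda>n. norm (\<Prod>i\<le>n. f i)) \<longlonglongrightarrow> norm P"
    by (intro tendsto_norm has_prod_imp_tendsto assms(1))
  have "norm (\<Prod>i\<le>n. f i) \<le> exp X" if "N \<le> n" for n
  proof -
    have "norm (\<Prod>i\<le>n. f i) = (\<Prod>i\<le>n. norm (f i))" by (simp add: prod_norm)
    also have "\<dots> \<le> (\<Prod>i\<le>n. exp (c i))" using assms(2) by (intro prod_mono) auto
    also have "\<dots> = exp (\<Sum>i\<le>n. c i)" by (simp add: exp_sum)
    also have "\<dots> \<le> exp X" using assms(3)[OF that] by simp
    finally show ?thesis .
  qed
  then show "\<exists>N. \<forall>n\<ge>N. norm (\<Prod>i\<le>n. f i) \<le> exp X" by blast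
qed

lemma norm_weierstrass_factor_le:
  "norm (weierstrass_factor k u) \<le> exp (norm u + (\<Sum>j=1..k. norm u ^ j))"
proof -
  have "norm (1 - u) \<le> 1 + norm u" using norm_triangle_ineq4[of 1 u] by simp
  also have "\<dots> \<le> exp (norm u)" by (rule exp_ge_add_one_self)
  finally have 1: "norm (1 - u) \<le> exp (norm u)" .
  have "norm (\<Sum>j=1..k. u ^ j / of_nat j) \<le> (\<Sum>j=1..k. norm u ^ j)"
  proof (rule sum_norm_le)
    fix j assume "j \<in> {1..k}"
    then have "norm u ^ j / real j \<le> norm u ^ j / 1" by (intro divide_left_mono) auto
    then show "norm (u ^ j / of_nat j) \<le> norm u ^ j" by (simp add: norm_divide norm_power)
  qed
  then have "Re (\<Sum>j=1..k. u ^ j / of_nat j) \<le> (\<Sum>j=1..k. norm u ^ j)"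
    using complex_Re_le_cmod order_trans by blast
  then have 2: "norm (exp (\<Sum>j=1..k. u ^ j / of_nat j)) \<le> exp (\<Sum>j=1..k. norm u ^ j)"
    by (simp add: norm_exp_eq_Re del: Re_sum)
  show ?thesis
    unfolding weierstrass_factor_def norm_mult exp_add by (intro mult_mono 1 2) auto
qed

text \<open>For \<open>norm u \<le> 1 / 2\<close> the factor differs from 1 by at most
  \<open>3 * norm u ^ Suc k\<close>. For larger \<open>u\<close> the crude bound suffices, since
  each power \<open>norm u ^ j\<close> with \<open>1 \<le> j\<close> and
  \<open>j \<le> Suc k\<close> is at most \<open>2 ^ k * norm u ^ Suc k\<close>.\<close>

lemma norm_weierstrass_factor_le_power:
  "norm (weierstrass_factor k u) \<le> exp (3 * (real k + 1) * 2 ^ k * norm u ^ Suc k)"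
proof (cases "norm u \<le> 1 / 2")
  case True
  have "norm (weierstrass_factor k u) \<le> 1 + 3 * norm u ^ Suc k"
    using weierstrass_factor_bound[OF True, of k]
      norm_triangle_sub[of "weierstrass_factor k u" 1] by simp
  also have "\<dots> \<le> exp (3 * norm u ^ Suc k)" by (rule exp_ge_add_one_self)
  also have "3 * norm u ^ Suc k \<le> 3 * (real k + 1) * 2 ^ k * norm u ^ Suc k"
  proof (rule mult_right_mono)
    have "1 * 1 \<le> (real k + 1) * 2 ^ k" by (intro mult_mono) auto
    then show "3 \<le> 3 * (real k + 1) * 2 ^ k" unfolding mult.assoc by linarith
  qed simp
  finally show ?thesis by simp
next
  case False
  have *: "norm u ^ j \<le> 2 ^ k * norm u ^ Suc k" if "1 \<le> j" "j \<le> Suc k" for j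
  proof -
    have "norm u ^ j = norm u ^ j * 1" by simp
    also have "1 \<le> (2 * norm u) ^ (Suc k - j)" using False by (intro one_le_power) auto
    then have "norm u ^ j * 1 \<le> norm u ^ j * (2 * norm u) ^ (Suc k - j)" by (intro mult_left_mono) auto
    also have "\<dots> = 2 ^ (Suc k - j) * norm u ^ (j + (Suc k - j))"
      by (simp add: power_mult_distrib power_add)
    also have "\<dots> \<le> 2 ^ k * norm u ^ (j + (Suc k - j))"
      using that by (intro mult_right_mono power_increasing) auto
    finally show ?thesis using that by simp
  qed
  have "norm u + (\<Sum>j=1..k. norm u ^ j) \<le> 2 ^ k * norm u ^ Suc k + (\<Sum>j=1..k. 2 ^ k * norm u ^ Suc k)"
    using *[of 1] by (intro add_mono sum_mono *) auto
  also have "\<dots> = (real k + 1) * 2 ^ k * norm u ^ Suc k" by (simp add: algebra_simps)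
  also have "\<dots> \<le> 3 * (real k + 1) * 2 ^ k * norm u ^ Suc k" by (intro mult_right_mono) auto
  finally have "norm u + (\<Sum>j=1..k. norm u ^ j) \<le> 3 * (real k + 1) * 2 ^ k * norm u ^ Suc k" .
  then show ?thesis using norm_weierstrass_factor_le[of k u] by (meson exp_le_cancel_iff order_trans)
qed

lemma norm_weierstrass_factor_le_max:
  assumes "max k 1 \<le> q"
  shows "norm (weierstrass_factor k u) \<le> exp ((real k + 1) * max 1 (norm u) ^ q)"
proof -
  let ?x = "max 1 (norm u)"
  have *: "norm u ^ j \<le> ?x ^ q" if "j \<le> q" for j
    using power_mono[of "norm u" ?x j] power_increasing[of j q ?x] that by simp
  have "norm u + (\<Sum>j=1..k. norm u ^ j) \<le> ?x ^ q + (\<Sum>j=1..k. ?x ^ q)"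
    using *[of 1] assms by (intro add_mono sum_mono *) auto
  also have "\<dots> = (real k + 1) * ?x ^ q" by (simp add: algebra_simps)
  finally show ?thesis using norm_weierstrass_factor_le[of k u] by (meson exp_le_cancel_iff order_trans)
qed

lemma norm_canonical_product_le:
  assumes sm: "summable (\<lambda>n. (1 / norm (a n)) ^ Suc k)"
    and P: "\<And>z. (\<lambda>n. weierstrass_factor k (z / a n)) has_prod P z"
  obtains C where "0 \<le> C" "\<And>z. norm (P z) \<le> exp (C * norm z ^ Suc k)"
proof
  define c where "c = 3 * (real k + 1) * 2 ^ k"
  define S where "S = (\<Sum>n. (1 / norm (a n)) ^ Suc k)"
  have c: "0 \<le> c" by (simp add: c_def)
  have S: "(\<Sum>i\<le>n. (1 / norm (a i)) ^ Suc k) \<le> S" for n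
    unfolding S_def by (rule sum_le_suminf[OF sm]) auto
  have "0 \<le> S" unfolding S_def using sm by (intro suminf_nonneg) auto
  then show "0 \<le> c * S" using c by simp
  show "norm (P z) \<le> exp (c * S * norm z ^ Suc k)" for z
  proof (rule has_prod_norm_le_exp[OF P, of z "\<lambda>i. c * norm z ^ Suc k * (1 / norm (a i)) ^ Suc k" 0])
    show "norm (weierstrass_factor k (z / a i)) \<le> exp (c * norm z ^ Suc k * (1 / norm (a i)) ^ Suc k)" for i
      using norm_weierstrass_factor_le_power[of k "z / a i"]
      by (simp add: c_def norm_divide power_divide del: power_Suc)
    show "(\<Sum>i\<le>n. c * norm z ^ Suc k * (1 / norm (a i)) ^ Suc k) \<le> c * S * norm z ^ Suc k" for n
    proof -
      have "(\<Sum>i\<le>n. c * norm z ^ Suc k * (1 / norm (a i)) ^ Suc k)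
          = c * norm z ^ Suc k * (\<Sum>i\<le>n. (1 / norm (a i)) ^ Suc k)"
        by (simp only: sum_distrib_left)
      also have "\<dots> \<le> c * norm z ^ Suc k * S" using c S by (intro mult_left_mono) auto
      finally show ?thesis by (simp only: mult_ac)
    qed
  qed
qed

text \<open>A canonical product of genus \<open>k\<close> has at most minimal type for the exponent
  \<open>Suc k\<close>. The tail of the series is made smaller than \<open>e / (2 * c)\<close>, and
  the finitely many remaining factors grow only with exponent \<open>q\<close>.\<close>

lemma norm_canonical_product_small:
  assumes sm: "summable (\<lambda>n. (1 / norm (a n)) ^ Suc k)"
    and P: "\<And>z. (\<lambda>n. weierstrass_factor k (z / a n)) has_prod P z"
    and q: "max k 1 \<le> q" and e: "0 < e"
  obtains R where "\<And>z. R \<le> norm z \<Longrightarrow> norm (P z) \<le> exp (e * norm z ^ Suc q)"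
proof -
  define c where "c = 3 * (real k + 1) * 2 ^ k"
  have c: "0 < c" by (simp add: c_def)
  define b where "b = (\<lambda>n. (1 / norm (a n)) ^ Suc k)"
  have b: "0 \<le> b n" for n by (simp add: b_def)
  have smb: "summable b" using sm by (simp add: b_def)
  have "\<exists>N. \<forall>n\<ge>N. norm (\<Sum>i. b (i + n)) < e / (2 * c)"
    using suminf_exist_split[OF _ smb, of "e / (2 * c)"] e c by simp
  then obtain N where N: "norm (\<Sum>i. b (i + N)) < e / (2 * c)" by blast
  have tail: "(\<Sum>i\<in>{N..n}. b i) \<le> e / (2 * c)" for n
  proof -
    have "(\<Sum>i\<in>{N..n}. b i) = (\<Sum>i<Suc n - N. b (i + N))"
      by (rule sum.reindex_bij_witness[of _ "\<lambda>i. i + N" "\<lambda>i. i - N"]) auto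
    also have "\<dots> \<le> (\<Sum>i. b (i + N))"
      using smb b by (intro sum_le_suminf) (auto simp: summable_iff_shift)
    finally show ?thesis using N by simp
  qed
  \<comment> \<open>The first \<open>N\<close> factors together contribute at most
    \<open>H * norm z ^ q\<close>, which the spare half of \<open>e\<close> absorbs once
    \<open>2 * H / e \<le> norm z\<close>.\<close>
  define H where "H = (\<Sum>i<N. (real k + 1) * max 1 (1 / norm (a i)) ^ q)"
  have H: "0 \<le> H" unfolding H_def by (intro sum_nonneg) auto
  show thesis
  proof (rule that[of "max 1 (2 * H / e)"])
    fix z :: complex assume "max 1 (2 * H / e) \<le> norm z"
    then have z: "1 \<le> norm z" "2 * H / e \<le> norm z" by auto
    define d where "d = (\<lambda>i. if i < N then (real k + 1) * max 1 (norm (z / a i)) ^ q else c * norm z ^ Suc k * b i)"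
    show "norm (P z) \<le> exp (e * norm z ^ Suc q)"
    proof (rule has_prod_norm_le_exp[OF P, of z d N])
      show "norm (weierstrass_factor k (z / a i)) \<le> exp (d i)" for i
        using norm_weierstrass_factor_le_power[of k "z / a i"] norm_weierstrass_factor_le_max[OF q, of "z / a i"]
        by (simp add: c_def d_def b_def norm_divide power_divide del: power_Suc)
      fix n assume n: "N \<le> n"
      have "(\<Sum>i\<le>n. d i) = (\<Sum>i\<in>{..<N} \<union> {N..n}. d i)"
        using n by (intro sum.cong) auto
      also have "\<dots> = (\<Sum>i<N. d i) + (\<Sum>i\<in>{N..n}. d i)" by (rule sum.union_disjoint) auto
      also have "(\<Sum>i<N. d i) \<le> (\<Sum>i<N. (real k + 1) * max 1 (1 / norm (a i)) ^ q * norm z ^ q)"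
      proof (rule sum_mono)
        fix i assume "i \<in> {..<N}"
        have "max 1 (norm (z / a i)) \<le> max 1 (1 / norm (a i)) * norm z"
        proof (rule max.boundedI)
          show "1 \<le> max 1 (1 / norm (a i)) * norm z" using mult_mono[of 1 "max 1 (1 / norm (a i))" 1 "norm z"] z by simp
          show "norm (z / a i) \<le> max 1 (1 / norm (a i)) * norm z"
            using mult_right_mono[of "1 / norm (a i)" "max 1 (1 / norm (a i))" "norm z"] by (simp add: norm_divide)
        qed
        then have "max 1 (norm (z / a i)) ^ q \<le> (max 1 (1 / norm (a i)) * norm z) ^ q" by (rule power_mono) simp
        then have "(real k + 1) * max 1 (norm (z / a i)) ^ q \<le> (real k + 1) * (max 1 (1 / norm (a i)) * norm z) ^ q"
          by (intro mult_left_mono) auto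
        with \<open>i \<in> {..<N}\<close> show "d i \<le> (real k + 1) * max 1 (1 / norm (a i)) ^ q * norm z ^ q"
          by (simp add: d_def power_mult_distrib)
      qed
      also have "\<dots> = H * norm z ^ q" by (simp only: H_def sum_distrib_right)
      also have "\<dots> \<le> (e / 2 * norm z) * norm z ^ q"
        using z e by (intro mult_right_mono) (auto simp: field_simps)
      also have "(\<Sum>i\<in>{N..n}. d i) = c * norm z ^ Suc k * (\<Sum>i\<in>{N..n}. b i)"
        by (simp add: d_def sum_distrib_left del: power_Suc)
      also have "\<dots> \<le> c * norm z ^ Suc k * (e / (2 * c))"
        using c tail by (intro mult_left_mono) auto
      also have "\<dots> = e / 2 * norm z ^ Suc k" using c by (simp add: field_simps)
      also have "\<dots> \<le> e / 2 * norm z ^ Suc q" using z e q by (intro mult_left_mono power_increasing) auto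
      finally show "(\<Sum>i\<le>n. d i) \<le> e * norm z ^ Suc q" by (simp add: algebra_simps)
    qed
  qed
qed

section \<open>The exponential factor against the canonical product\<close>

lemma norm_poly_le:
  fixes Q :: "complex poly"
  assumes "degree Q \<le> d" "1 \<le> norm z"
  shows "norm (poly Q z) \<le> (\<Sum>i\<le>degree Q. norm (coeff Q i)) * norm z ^ d"
proof -
  have "norm (poly Q z) \<le> (\<Sum>i\<le>degree Q. norm (coeff Q i * z ^ i))"
    unfolding poly_altdef by (rule norm_sum)
  also have "\<dots> \<le> (\<Sum>i\<le>degree Q. norm (coeff Q i) * norm z ^ d)"
    using assms by (intro sum_mono) (auto simp: norm_mult norm_power intro!: mult_left_mono power_increasing)
  finally show ?thesis by (simp add: sum_distrib_right)
qed

lemma rotation_pigeonhole: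
  fixes w :: complex
  shows "\<exists>j<4. norm w / 2 \<le> Re (\<i> ^ j * w)"
proof -
  have "norm w \<le> \<bar>Re w\<bar> + \<bar>Im w\<bar>" by (rule cmod_le)
  then consider "norm w / 2 \<le> Re w" | "norm w / 2 \<le> - Re w" | "norm w / 2 \<le> Im w" | "norm w / 2 \<le> - Im w"
    by linarith
  then show ?thesis
  proof cases
    case 1 then show ?thesis by (intro exI[of _ 0]) simp
  next
    case 2 then show ?thesis by (intro exI[of _ 2]) simp
  next
    case 3 then show ?thesis by (intro exI[of _ 3]) (simp add: power3_eq_cube)
  next
    case 4 then show ?thesis by (intro exI[of _ 1]) simp
  qed
qed

text \<open>Averaging over rotations replaces Jensen's formula: by the maximum principle the product of
  the rotated functions is at least \<open>norm (P 0) ^ n\<close> somewhere on each circle.\<close>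
lemma product_of_rotations:
  assumes P: "P holomorphic_on UNIV" and r: "0 < r"
  obtains z where "norm z = r" "norm (P 0) ^ n \<le> (\<Prod>j<n. norm (P (\<omega> ^ j * z)))"
proof (rule ccontr)
  assume "\<not> thesis"
  then have less: "(\<Prod>j<n. norm (P (\<omega> ^ j * z))) < norm (P 0) ^ n" if "norm z = r" for z
    using that not_le \<open>\<And>z. norm z = r \<Longrightarrow> norm (P 0) ^ n \<le> (\<Prod>j<n. norm (P (\<omega> ^ j * z))) \<Longrightarrow> thesis\<close> by blast
  define G where "G = (\<lambda>z. \<Prod>j<n. P (\<omega> ^ j * z))"
  have "(\<lambda>z. P (\<omega> ^ j * z)) holomorphic_on UNIV" for j
    using holomorphic_on_compose[of "\<lambda>z. \<omega> ^ j * z" UNIV P] holomorphic_on_subset[OF P]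
    by (simp add: o_def holomorphic_intros)
  then have G: "G holomorphic_on UNIV" unfolding G_def by (intro holomorphic_on_prod)
  have cont: "continuous_on (sphere 0 r) (\<lambda>z. norm (G z))"
    by (intro continuous_on_norm continuous_on_subset[OF holomorphic_on_imp_continuous_on[OF G]]) simp
  have "sphere (0::complex) r \<noteq> {}" using r by simp
  then obtain z where z: "z \<in> sphere 0 r" "\<And>w. w \<in> sphere 0 r \<Longrightarrow> norm (G w) \<le> norm (G z)"
    using continuous_attains_sup[OF compact_sphere _ cont] by blast
  have "norm (G 0) \<le> norm (G z)"
    by (rule maximum_modulus_cball[OF G, of 0 r]) (use z r in auto)
  then show False using less[of z] z(1) by (simp add: G_def prod_norm norm_power)
qed

text \<open>If \<open>A\<close> were small on a whole circle, \<open>P\<close> would have to be tiny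
  at a point where the exponential factor is large. By \<open>small\<close> it cannot compensate at
  the other rotated points, so the product over all rotations would fall below
  \<open>norm (P 0) ^ n\<close>.\<close>

lemma exp_poly_mult_large:
  fixes Q :: "complex poly"
  assumes A: "\<And>z. A z = exp (poly Q z) * P z" and P: "P holomorphic_on UNIV" "P 0 \<noteq> 0"
    and d: "degree Q = d" "1 \<le> d"
    and small: "\<And>e. 0 < e \<Longrightarrow> \<exists>R. \<forall>z. R \<le> norm z \<longrightarrow> norm (P z) \<le> exp (e * norm z ^ d)"
  obtains e R where "0 < e" "\<And>r. R \<le> r \<Longrightarrow> \<exists>z. norm z = r \<and> exp (e * r ^ d) \<le> norm (A z)"
proof -
  define c where "c = lead_coeff Q"
  have "c \<noteq> 0" using d by (auto simp: c_def)
  define Q' where "Q' = Q - monom c d"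
  have dQ': "degree Q' \<le> d - 1"
  proof (rule degree_le, intro allI impI)
    fix i assume "d - 1 < i"
    then show "coeff Q' i = 0" using d by (cases "i = d") (auto simp: Q'_def c_def coeff_eq_0)
  qed
  define S where "S = (\<Sum>i\<le>degree Q'. norm (coeff Q' i))"
  \<comment> \<open>The leading term will supply a half of \<open>norm c * norm z ^ d\<close>; the
    lower terms may use up a quarter.\<close>
  have ReQ: "Re (c * z ^ d) - norm c / 4 * norm z ^ d \<le> Re (poly Q z)"
    if z: "1 \<le> norm z" "4 * S / norm c \<le> norm z" for z
  proof -
    have "S \<le> norm c / 4 * norm z" using z(2) \<open>c \<noteq> 0\<close> by (simp add: field_simps)
    then have "S * norm z ^ (d - 1) \<le> norm c / 4 * norm z * norm z ^ (d - 1)"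
      by (rule mult_right_mono) simp
    also have "\<dots> = norm c / 4 * norm z ^ d" using d(2) by (simp add: power_eq_if)
    finally have "norm (poly Q' z) \<le> norm c / 4 * norm z ^ d"
      using norm_poly_le[OF dQ' z(1)] unfolding S_def by linarith
    moreover have "poly Q z = c * z ^ d + poly Q' z" by (simp add: Q'_def poly_monom)
    moreover have "- norm (poly Q' z) \<le> Re (poly Q' z)" using abs_Re_le_cmod[of "poly Q' z"] by linarith
    ultimately show ?thesis by simp
  qed
  \<comment> \<open>With this \<open>n\<close> the rotation satisfies
    \<open>\<omega> ^ d = \<i>\<close>, so the first four rotations multiply the leading term by the
    four powers of \<open>\<i>\<close>, and \<open>rotation_pigeonhole\<close> finds a good
    one.\<close>
  define n where "n = 4 * d"
  define \<omega> where "\<omega> = cis (2 * pi / n)"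
  have n0: "0 < n" using d by (simp add: n_def)
  have \<omega>d: "\<omega> ^ d = \<i>"
  proof -
    have "real d * (2 * pi / n) = pi / 2" using d by (simp add: n_def field_simps)
    moreover have "\<omega> ^ d = cis (real d * (2 * pi / n))" by (simp only: \<omega>_def Complex.DeMoivre)
    ultimately show ?thesis by (simp only: cis_pi_half)
  qed
  \<comment> \<open>The \<open>n\<close> factors lose at most \<open>n * e = norm c / 8\<close> in
    the exponent, half of the \<open>norm c / 4\<close> gained at the good rotation.\<close>
  define e where "e = norm c / (8 * n)"
  have e0: "0 < e" using \<open>c \<noteq> 0\<close> n0 by (simp add: e_def)
  obtain R where R: "\<And>z. R \<le> norm z \<Longrightarrow> norm (P z) \<le> exp (e * norm z ^ d)"
    using small[OF e0] by blast
  define L where "L = \<bar>ln (norm (P 0) ^ n)\<bar>"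
  define R' where "R' = Max {1, R, 4 * S / norm c, 8 * (L + 1) / norm c}"
  show thesis
  proof (rule that[OF e0, of R'])
    fix r assume "R' \<le> r"
    moreover have "1 \<le> R'" "R \<le> R'" "4 * S / norm c \<le> R'" "8 * (L + 1) / norm c \<le> R'"
      unfolding R'_def by (auto intro!: Max_ge)
    ultimately have r: "1 \<le> r" "R \<le> r" "4 * S / norm c \<le> r" "8 * (L + 1) / norm c \<le> r" by auto
    show "\<exists>z. norm z = r \<and> exp (e * r ^ d) \<le> norm (A z)"
    proof (rule ccontr)
      assume "\<not> ?thesis"
      then have Aless: "norm (A z) < exp (e * r ^ d)" if "norm z = r" for z using that by force
      obtain z where z: "norm z = r" "norm (P 0) ^ n \<le> (\<Prod>j<n. norm (P (\<omega> ^ j * z)))"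
        using product_of_rotations[OF P(1), of r n \<omega>] r by auto
      have nz: "norm (\<omega> ^ j * z) = r" for j using z by (simp add: \<omega>_def norm_mult norm_power)
      obtain j where j: "j < 4" "norm (c * z ^ d) / 2 \<le> Re (\<i> ^ j * (c * z ^ d))"
        using rotation_pigeonhole by blast
      have jn: "j < n" using j(1) d by (simp add: n_def)
      define v where "v = \<omega> ^ j * z"
      have v: "norm v = r" unfolding v_def by (rule nz)
      have cv: "c * v ^ d = \<i> ^ j * (c * z ^ d)"
        by (simp add: v_def power_mult_distrib power_mult[symmetric] mult.commute[of j] flip: \<omega>d)
      have "norm c * r ^ d / 2 \<le> Re (c * v ^ d)"
        using j(2) unfolding cv norm_mult norm_power z(1) .
      then have "norm c / 4 * r ^ d \<le> Re (poly Q v)" using ReQ[of v] v r by simp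
      moreover have "norm (A v) = exp (Re (poly Q v)) * norm (P v)" by (simp add: A norm_mult norm_exp_eq_Re)
      ultimately have "exp (norm c / 4 * r ^ d) * norm (P v) \<le> exp (e * r ^ d)"
        using Aless[OF v] by (smt (verit) exp_le_cancel_iff mult_right_mono norm_ge_zero)
      then have Pv: "norm (P v) \<le> exp (e * r ^ d - norm c / 4 * r ^ d)"
        by (simp add: exp_diff pos_le_divide_eq mult.commute)
      define b where "b = (\<lambda>i. e * r ^ d - (if i = j then norm c / 4 * r ^ d else 0))"
      have "(\<Prod>i<n. norm (P (\<omega> ^ i * z))) \<le> (\<Prod>i<n. exp (b i))"
        using Pv R[of "\<omega> ^ i * z" for i] nz r by (intro prod_mono) (auto simp: b_def v_def)
      also have "\<dots> = exp (\<Sum>i<n. b i)" by (simp add: exp_sum)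
      also have "(\<Sum>i<n. b i) = real n * (e * r ^ d) - norm c / 4 * r ^ d"
        using jn by (simp add: b_def sum_subtractf sum.delta)
      also have "\<dots> = - (norm c / 8 * r ^ d)" using n0 by (simp add: e_def field_simps)
      finally have "norm (P 0) ^ n \<le> exp (- (norm c / 8 * r ^ d))" using z(2) by simp
      then have "ln (norm (P 0) ^ n) \<le> - (norm c / 8 * r ^ d)"
        using P(2) by (metis ln_exp ln_le_cancel_iff exp_gt_zero zero_less_norm_iff zero_less_power)
      then have "norm c / 8 * r ^ d \<le> L" by (simp add: L_def)
      moreover have "norm c / 8 * r \<le> norm c / 8 * r ^ d"
        using r d power_increasing[of 1 d r] by (intro mult_left_mono) auto
      moreover have "L + 1 \<le> norm c / 8 * r" using r(4) \<open>c \<noteq> 0\<close> by (simp add: field_simps)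
      ultimately show False by simp
    qed
  qed
qed

subsection \<open>Growth order and angular sectors\<close>

lemma bdd_above_norm_sphere:
  assumes "A holomorphic_on UNIV"
  shows "bdd_above ((\<lambda>z. norm (A z)) ` sphere (0::complex) r)"
proof -
  have "continuous_on (sphere 0 r) A"
    using continuous_on_subset[OF holomorphic_on_imp_continuous_on[OF assms]] by blast
  then have "compact ((\<lambda>z. norm (A z)) ` sphere 0 r)"
    by (intro compact_continuous_image continuous_on_norm compact_sphere)
  then show ?thesis by (intro bounded_imp_bdd_above compact_imp_bounded)
qed

lemma norm_le_max_modulus:
  "A holomorphic_on UNIV \<Longrightarrow> norm (A z) \<le> max_modulus A (norm z)"
  unfolding max_modulus_def by (rule cSUP_upper[OF _ bdd_above_norm_sphere]) auto

lemma max_modulus_le: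
  "0 \<le> r \<Longrightarrow> (\<And>z. norm z = r \<Longrightarrow> norm (A z) \<le> M) \<Longrightarrow> max_modulus A r \<le> M"
  unfolding max_modulus_def by (rule cSUP_least) auto

lemma log_plus_mono: "x \<le> y \<Longrightarrow> log_plus x \<le> log_plus y"
  unfolding log_plus_def by simp

lemma log_plus_exp: "0 \<le> x \<Longrightarrow> log_plus (exp x) = x"
  unfolding log_plus_def by (simp add: max_absorb2)

lemma tendsto_log_power_over_log:
  assumes "0 < c"
  shows "((\<lambda>r::real. ereal (ln (c * r ^ d) / ln r)) \<longlongrightarrow> ereal d) at_top"
proof -
  have "((\<lambda>r::real. ln c / ln r + d) \<longlongrightarrow> 0 + real d) at_top"
    by (intro tendsto_intros tendsto_divide_0[OF tendsto_const] filterlim_at_top_imp_at_infinity ln_at_top)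
  then have "((\<lambda>r::real. ereal (ln c / ln r + d)) \<longlongrightarrow> ereal d) at_top" by simp
  moreover have "\<forall>\<^sub>F r in at_top. ereal (ln (c * r ^ d) / ln r) = ereal (ln c / ln r + d)"
    using eventually_gt_at_top[of "1::real"]
    by eventually_elim (use assms in \<open>simp add: ln_mult ln_realpow add_divide_distrib\<close>)
  ultimately show ?thesis using tendsto_cong by fastforce
qed

lemma growth_order_le:
  assumes "\<And>z. R \<le> norm z \<Longrightarrow> norm (A z) \<le> exp (C * norm z ^ d)"
  shows "growth_order A \<le> ereal d"
proof -
  \<comment> \<open>Taking at least 1 keeps \<open>c * r ^ d \<ge> 1\<close> for
    \<open>r > 1\<close>, where \<open>log_plus\<close> is the plain logarithm.\<close>
  define c where "c = max 1 C"
  have "growth_order A \<le> Limsup at_top (\<lambda>r::real. ereal (ln (c * r ^ d) / ln r))"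
    unfolding growth_order_def
  proof (rule Limsup_mono)
    show "\<forall>\<^sub>F r in at_top. ereal (log_plus (log_plus (max_modulus A r)) / ln r) \<le> ereal (ln (c * r ^ d) / ln r)"
      using eventually_gt_at_top[of "1::real"] eventually_ge_at_top[of R]
    proof eventually_elim
      case (elim r)
      have cr: "1 \<le> c * r ^ d" using mult_mono[of 1 c 1 "r ^ d"] one_le_power[of r d] elim by (simp add: c_def)
      have "C * r ^ d \<le> c * r ^ d" using elim by (intro mult_right_mono) (auto simp: c_def)
      then have "exp (C * r ^ d) \<le> exp (c * r ^ d)" by simp
      then have "max_modulus A r \<le> exp (c * r ^ d)"
        using elim order_trans[OF assms] by (intro max_modulus_le) auto
      then have "log_plus (max_modulus A r) \<le> c * r ^ d"
        using log_plus_mono log_plus_exp[of "c * r ^ d"] cr by fastforce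
      then have "log_plus (log_plus (max_modulus A r)) \<le> log_plus (c * r ^ d)" by (rule log_plus_mono)
      also have "\<dots> = ln (c * r ^ d)" using cr by (simp add: log_plus_def)
      finally show ?case using elim by (simp add: divide_right_mono)
    qed
  qed
  also have "\<dots> = ereal d"
    by (rule lim_imp_Limsup[OF _ tendsto_log_power_over_log]) (auto simp: c_def)
  finally show ?thesis .
qed

lemma growth_order_ge:
  assumes A: "A holomorphic_on UNIV" and c: "0 < c"
    and large: "\<And>r. R \<le> r \<Longrightarrow> \<exists>z. norm z = r \<and> exp (c * r ^ d) \<le> norm (A z)"
  shows "ereal d \<le> growth_order A"
proof -
  have "ereal d = Limsup at_top (\<lambda>r::real. ereal (ln (c * r ^ d) / ln r))"
    by (rule lim_imp_Limsup[OF _ tendsto_log_power_over_log, symmetric]) (use c in auto)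
  also have "\<dots> \<le> growth_order A"
    unfolding growth_order_def
  proof (rule Limsup_mono)
    show "\<forall>\<^sub>F r in at_top. ereal (ln (c * r ^ d) / ln r) \<le> ereal (log_plus (log_plus (max_modulus A r)) / ln r)"
      using eventually_gt_at_top[of "1::real"] eventually_ge_at_top[of R]
    proof eventually_elim
      case (elim r)
      have cr: "0 < c * r ^ d" using c elim by simp
      obtain z where "norm z = r" "exp (c * r ^ d) \<le> norm (A z)" using large elim by blast
      then have "exp (c * r ^ d) \<le> max_modulus A r" using norm_le_max_modulus[OF A, of z] by simp
      then have "c * r ^ d \<le> log_plus (max_modulus A r)"
        using log_plus_mono log_plus_exp[of "c * r ^ d"] cr by fastforce
      then have "ln (c * r ^ d) \<le> log_plus (log_plus (max_modulus A r))"
        using cr by (simp add: log_plus_def)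
      then show ?case using elim by (simp add: divide_right_mono)
    qed
  qed
  finally show ?thesis .
qed

lemma finite_growth_order_bound:
  assumes f: "f holomorphic_on UNIV" and "growth_order f \<noteq> \<infinity>"
  obtains q R where "\<And>z. R \<le> norm z \<Longrightarrow> norm (f z) \<le> exp (norm z ^ q)"
proof -
  obtain q :: nat where "growth_order f < ereal q"
    using assms(2) less_PInf_Ex_of_nat by auto
  then have "\<forall>\<^sub>F r in at_top. ereal (log_plus (log_plus (max_modulus f r)) / ln r) < ereal q"
    unfolding growth_order_def by (rule Limsup_lessD)
  then have "\<forall>\<^sub>F r in at_top. max_modulus f r \<le> exp (r ^ q)"
    using eventually_gt_at_top[of "1::real"]
  proof eventually_elim
    case (elim r)
    then have "log_plus (log_plus (max_modulus f r)) \<le> ln (r ^ q)"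
      by (simp add: ln_realpow pos_divide_less_eq)
    then have "max 1 (log_plus (max_modulus f r)) \<le> r ^ q"
      using elim(2) unfolding log_plus_def[of "log_plus _"] by (subst (asm) ln_le_cancel_iff) auto
    then have "ln (max 1 (max_modulus f r)) \<le> r ^ q" by (simp add: log_plus_def)
    then have "max 1 (max_modulus f r) \<le> exp (r ^ q)"
      by (metis exp_le_cancel_iff exp_ln less_max_iff_disj zero_less_one)
    then show ?case by simp
  qed
  then obtain R where R: "\<And>r. R \<le> r \<Longrightarrow> max_modulus f r \<le> exp (r ^ q)"
    unfolding eventually_at_top_linorder by blast
  show thesis
    by (rule that[of R q]) (use R norm_le_max_modulus[OF f] order_trans in blast)
qed

section \<open>Directions in which the canonical product decays\<close>

lemma cos_nat_pi_add: "cos (real n * pi + x) = (-1) ^ n * cos x"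
  by (simp add: cos_add sin_npi cos_npi)

lemma cos_neg_between: "pi / 2 < x \<Longrightarrow> x < 3 * pi / 2 \<Longrightarrow> cos x < 0"
  using cos_gt_zero_pi[of "x - pi"] by (simp add: cos_diff)

text \<open>The interval surrounds \<open>pi\<close> if \<open>p\<close> is odd and lies to the left of \<open>pi\<close> if \<open>p\<close> is even; its length is
  exactly the bound on the width of the sector.\<close>
lemma good_directions:
  assumes p: "1 \<le> p"
    and "odd p \<Longrightarrow> w < pi / (real p + 1)"
    and "even p \<Longrightarrow> w < (2 * real p - 1) * pi / (2 * real p * (real p + 1))"
  obtains a b where "w < b - a"
    "\<And>x. a < x \<Longrightarrow> x < b \<Longrightarrow> 0 < cos (real (Suc p) * x) \<and> cos (real p * x) < 0"
proof (cases "even p")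
  case False
  define h where "h = pi / (2 * (real p + 1))"
  have h: "(real p + 1) * h = pi / 2" by (simp add: h_def field_simps)
  show thesis
  proof (rule that[of "pi + h" "pi - h"])
    have "2 * h = pi / (real p + 1)" by (simp add: h_def frac_eq_eq)
    then show "w < pi + h - (pi - h)" using assms(2) False by simp
  next
    fix x assume x: "pi - h < x" "x < pi + h"
    define y where "y = x - pi"
    have y: "\<bar>y\<bar> < h" using x by (auto simp: y_def)
    then have "(real p + 1) * \<bar>y\<bar> < (real p + 1) * h" by (intro mult_strict_left_mono) auto
    then have 1: "\<bar>(real p + 1) * y\<bar> < pi / 2" by (simp add: h abs_mult)
    have "real p * \<bar>y\<bar> \<le> (real p + 1) * \<bar>y\<bar>" by (intro mult_right_mono) auto
    then have 2: "\<bar>real p * y\<bar> < pi / 2" using 1 by (simp add: abs_mult)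
    have "cos (real (Suc p) * x) = cos ((real p + 1) * y)"
      using cos_nat_pi_add[of "Suc p" "(real p + 1) * y"] False by (simp add: y_def algebra_simps)
    moreover have "cos (real p * x) = - cos (real p * y)"
      using cos_nat_pi_add[of p "real p * y"] False by (simp add: y_def algebra_simps)
    ultimately show "0 < cos (real (Suc p) * x) \<and> cos (real p * x) < 0"
      using cos_gt_zero_pi[of "(real p + 1) * y"] cos_gt_zero_pi[of "real p * y"] 1 2 by auto
  qed
next
  case True
  \<comment> \<open>For even \<open>p\<close> both signs are wrong at \<open>pi\<close>. At distance
    \<open>y\<close> to its left, \<open>cos (p * y)\<close> is negative as soon as \<open>y\<close>
    passes \<open>g\<close>, while \<open>cos ((p + 1) * y)\<close> remains negative until
    \<open>y\<close> reaches \<open>h\<close>.\<close>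
  define g where "g = pi / (2 * real p)"
  define h where "h = 3 * pi / (2 * (real p + 1))"
  have g: "real p * g = pi / 2" using p by (simp add: g_def)
  have h: "(real p + 1) * h = 3 * pi / 2" by (simp add: h_def field_simps)
  show thesis
  proof (rule that[of "pi - g" "pi - h"])
    have "h - g = (2 * real p - 1) * pi / (2 * real p * (real p + 1))"
      using p by (simp add: g_def h_def diff_frac_eq frac_eq_eq) (simp add: algebra_simps)
    then show "w < pi - g - (pi - h)" using assms(3) True by simp
  next
    fix x assume x: "pi - h < x" "x < pi - g"
    define y where "y = pi - x"
    have y: "g < y" "y < h" using x by (auto simp: y_def)
    have "0 < g" using p by (simp add: g_def)
    have 1: "pi / 2 < real p * y" unfolding g[symmetric] using y p by (intro mult_strict_left_mono) auto
    have 2: "(real p + 1) * y < 3 * pi / 2"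
      unfolding h[symmetric] using y by (intro mult_strict_left_mono) auto
    have 3: "real p * y < (real p + 1) * y" using y \<open>0 < g\<close> by (intro mult_strict_right_mono) auto
    have "real (Suc p) * x = real (Suc p) * pi + - ((real p + 1) * y)" "real p * x = real p * pi + - (real p * y)"
      by (simp_all add: y_def algebra_simps)
    then have "cos (real (Suc p) * x) = - cos ((real p + 1) * y)" "cos (real p * x) = cos (real p * y)"
      using True by (simp_all only: cos_nat_pi_add cos_minus) simp_all
    then show "0 < cos (real (Suc p) * x) \<and> cos (real p * x) < 0"
      using cos_neg_between[of "(real p + 1) * y"] cos_neg_between[of "real p * y"] 1 2 3 by auto
  qed
qed

text \<open>Since the sector is narrower than the good interval, there are \<open>\<theta>\<close>
  for which \<open>\<theta> - \<phi>\<close> stays in that interval for all \<open>\<phi>\<close> of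
  the sector; a compact subinterval turns strict signs into a uniform
  \<open>\<delta>\<close>.\<close>

lemma decay_sector:
  assumes "1 \<le> p" and "\<theta>1 < \<theta>2"
    and "odd p \<Longrightarrow> \<theta>2 - \<theta>1 < pi / (real p + 1)"
    and "even p \<Longrightarrow> \<theta>2 - \<theta>1 < (2 * real p - 1) * pi / (2 * real p * (real p + 1))"
  obtains \<alpha> \<beta> \<delta> where "\<alpha> < \<beta>" "0 < \<delta>"
    "\<And>\<theta> \<phi>. \<alpha> < \<theta> \<Longrightarrow> \<theta> < \<beta> \<Longrightarrow> \<theta>1 < \<phi> \<Longrightarrow> \<phi> < \<theta>2 \<Longrightarrow>
      \<delta> \<le> cos (real (Suc p) * (\<theta> - \<phi>)) \<and> cos (real p * (\<theta> - \<phi>)) \<le> - \<delta>"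
proof -
  obtain a b where ab: "\<theta>2 - \<theta>1 < b - a"
    "\<And>x. a < x \<Longrightarrow> x < b \<Longrightarrow> 0 < cos (real (Suc p) * x) \<and> cos (real p * x) < 0"
    using good_directions[OF assms(1,3,4)] by blast
  \<comment> \<open>A quarter of the slack is cut off at each end, which leaves an interval of
    length \<open>2 * e\<close> for \<open>\<theta>\<close>.\<close>
  define e where "e = (b - a - (\<theta>2 - \<theta>1)) / 4"
  have e: "0 < e" "a + e + \<theta>2 < b - e + \<theta>1" using ab(1) by (auto simp: e_def field_simps)
  have ne: "{a + e..b - e} \<noteq> {}" using e assms(2) by auto
  define m where "m = (\<lambda>x. min (cos (real (Suc p) * x)) (- cos (real p * x)))"
  have "continuous_on {a + e..b - e} m" unfolding m_def by (intro continuous_intros)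
  then obtain x0 where x0: "x0 \<in> {a + e..b - e}" "\<And>x. x \<in> {a + e..b - e} \<Longrightarrow> m x0 \<le> m x"
    using continuous_attains_inf[OF compact_Icc ne] by blast
  show thesis
  proof (rule that[of "a + e + \<theta>2" "b - e + \<theta>1" "m x0"])
    show "a + e + \<theta>2 < b - e + \<theta>1" by (rule e)
    show "0 < m x0" using ab(2)[of x0] x0(1) e by (auto simp: m_def)
    fix \<theta> \<phi> assume "a + e + \<theta>2 < \<theta>" "\<theta> < b - e + \<theta>1" "\<theta>1 < \<phi>" "\<phi> < \<theta>2"
    then have "m x0 \<le> m (\<theta> - \<phi>)" by (intro x0(2)) auto
    moreover have "m (\<theta> - \<phi>) \<le> cos (real (Suc p) * (\<theta> - \<phi>))" "m (\<theta> - \<phi>) \<le> - cos (real p * (\<theta> - \<phi>))"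
      unfolding m_def by (rule min.cobounded1, rule min.cobounded2)
    ultimately show "m x0 \<le> cos (real (Suc p) * (\<theta> - \<phi>)) \<and> cos (real p * (\<theta> - \<phi>)) \<le> - m x0"
      by linarith
  qed
qed

text \<open>With \<open>u = rcis x \<psi>\<close>, the logarithm of the primary factor along the segment \<open>s * u\<close> has derivative
  \<open>- u ^ (p + 1) * s ^ p / (1 - s * u)\<close>; after multiplication by the conjugate of the denominator,
  its real part involves just the cosines of \<open>(p + 1) * \<psi>\<close> and \<open>p * \<psi>\<close>.\<close>
lemma norm_weierstrass_factor_decay:
  assumes x: "0 < x" and d: "0 < \<delta>"
    and c1: "\<delta> \<le> cos (real (Suc p) * \<psi>)" and c2: "cos (real p * \<psi>) \<le> - \<delta>"
  shows "norm (weierstrass_factor p (rcis x \<psi>)) \<le> exp (- (\<delta> / (real (Suc p) * (1 + x)) * x ^ Suc p))"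
proof -
  define u where "u = rcis x \<psi>"
  have nu: "norm u = x" using x by (simp add: u_def)
  \<comment> \<open>The segment stays off the branch cut of \<open>Ln\<close>: otherwise
    \<open>u\<close> would be a positive real, so \<open>cos (p * \<psi>) = 1\<close>, against
    \<open>c2\<close>.\<close>
  have slit: "1 - of_real s * u \<notin> \<real>\<^sub>\<le>\<^sub>0" if s: "0 \<le> s" for s :: real
  proof
    assume "1 - of_real s * u \<in> \<real>\<^sub>\<le>\<^sub>0"
    then obtain y where y: "1 - of_real s * u = of_real y" "y \<le> 0" unfolding nonpos_Reals_def by auto
    then have eq: "of_real s * u = complex_of_real (1 - y)" by (simp add: algebra_simps)
    then have "norm (of_real s * u) = 1 - y" using y(2) by (metis abs_of_nonneg diff_ge_0_iff_ge norm_of_real order_trans zero_le_one)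
    then have sx: "s * x = 1 - y" using s by (simp add: norm_mult nu)
    have "complex_of_real (s * x) * cis \<psi> = of_real s * u" by (simp add: u_def rcis_def)
    then have "complex_of_real (s * x) * cis \<psi> = complex_of_real (s * x) * 1"
      unfolding eq sx by simp
    moreover have "s * x \<noteq> 0" using sx y(2) by linarith
    ultimately have "cis \<psi> = 1" by (metis mult_left_cancel of_real_eq_0_iff)
    then have "cis (real p * \<psi>) = 1" by (simp flip: Complex.DeMoivre)
    then have "cos (real p * \<psi>) = 1" by (metis cis.sel(1) one_complex.sel(1))
    with c2 d show False by simp
  qed
  define L where "L = (\<lambda>w. Ln (1 - w * u) + (\<Sum>k=1..p. (w * u) ^ k / of_nat k))"
  define D where "D = (\<lambda>w. - (u ^ Suc p * w ^ p / (1 - w * u)))"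
  have L: "(L has_field_derivative D w) (at w)" if w: "1 - w * u \<notin> \<real>\<^sub>\<le>\<^sub>0" for w
  proof -
    have nz: "1 - w * u \<noteq> 0" using w by auto
    have s: "((\<lambda>w. \<Sum>k=1..p. (w * u) ^ k / of_nat k) has_field_derivative (\<Sum>k=1..p. u * (w * u) ^ (k - 1))) (at w)"
    proof (rule DERIV_sum)
      fix k assume "k \<in> {1..p}"
      then obtain j where j: "k = Suc j" by (cases k) auto
      have "(of_nat (Suc j) :: complex) \<noteq> 0" by (rule of_nat_neq_0)
      then show "((\<lambda>w. (w * u) ^ k / of_nat k) has_field_derivative u * (w * u) ^ (k - 1)) (at w)"
        unfolding j by (auto intro!: derivative_eq_intros simp del: power_Suc of_nat_Suc)
    qed
    have "(\<Sum>k=1..p. u * (w * u) ^ (k - 1)) = (\<Sum>j<p. u * (w * u) ^ j)"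
      by (rule sum.reindex_bij_witness[of _ Suc "\<lambda>k. k - 1"]) auto
    also have "\<dots> = u * ((1 - (w * u) ^ p) / (1 - w * u))"
      using sum_gp_strict[of "w * u" p] nz by (auto simp: sum_distrib_left[symmetric])
    finally have geo: "(\<Sum>k=1..p. u * (w * u) ^ (k - 1)) = u * ((1 - (w * u) ^ p) / (1 - w * u))" .
    have "((\<lambda>w. Ln (1 - w * u)) has_field_derivative (- u / (1 - w * u))) (at w)"
      using w by (auto intro!: derivative_eq_intros simp: divide_inverse)
    from DERIV_add[OF this s] have "(L has_field_derivative (- u / (1 - w * u) + u * ((1 - (w * u) ^ p) / (1 - w * u)))) (at w)"
      unfolding L_def geo .
    also have "- u / (1 - w * u) + u * ((1 - (w * u) ^ p) / (1 - w * u)) = D w"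
      by (simp add: D_def diff_divide_distrib right_diff_distrib power_mult_distrib mult_ac)
    finally show ?thesis .
  qed
  \<comment> \<open>Both cosine terms contribute with the same sign, so the numerator is at least
    \<open>\<delta> * x ^ Suc p * (1 + s * x)\<close>; the squared denominator is at most
    \<open>(1 + s * x)^2\<close>, and \<open>s \<le> 1\<close>.\<close>
  define K where "K = \<delta> / (1 + x) * x ^ Suc p"
  have ReD: "Re (D (of_real s)) \<le> - (K * s ^ p)" if s: "0 \<le> s" "s \<le> 1" for s :: real
  proof -
    define v where "v = 1 - of_real s * u"
    have v0: "v \<noteq> 0" using slit[OF s(1)] by (auto simp: v_def)
    have nv: "norm v \<le> 1 + s * x"
      using norm_triangle_ineq4[of 1 "of_real s * u"] s by (simp add: v_def norm_mult nu)
    have "u ^ Suc p * cnj v = u ^ Suc p - of_real (s * x\<^sup>2) * u ^ p"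
      using complex_norm_square[of u] by (simp add: v_def nu algebra_simps)
    then have "Re (u ^ Suc p * cnj v) = x ^ Suc p * cos (real (Suc p) * \<psi>) - s * x\<^sup>2 * (x ^ p * cos (real p * \<psi>))"
      by (simp add: u_def DeMoivre2 Re_rcis del: power_Suc of_nat_Suc)
    also have "\<dots> \<ge> x ^ Suc p * \<delta> - s * x\<^sup>2 * (x ^ p * (- \<delta>))"
      using c1 c2 x s by (intro diff_mono mult_left_mono) auto
    finally have "\<delta> * x ^ Suc p * (1 + s * x) \<le> Re (u ^ Suc p * cnj v)"
      by (simp add: algebra_simps power2_eq_square)
    moreover have "Re (u ^ Suc p / v) = Re (u ^ Suc p * cnj v) / (norm v)\<^sup>2"
      by (subst complex_div_cnj) (simp flip: of_real_power)
    ultimately have "\<delta> * x ^ Suc p * (1 + s * x) / (norm v)\<^sup>2 \<le> Re (u ^ Suc p / v)"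
      by (simp add: divide_right_mono)
    moreover have "\<delta> * x ^ Suc p * (1 + s * x) / (1 + s * x)\<^sup>2 \<le> \<delta> * x ^ Suc p * (1 + s * x) / (norm v)\<^sup>2"
      using d x s v0 nv by (intro divide_left_mono power_mono mult_nonneg_nonneg mult_pos_pos) auto
    moreover have "\<delta> * x ^ Suc p * (1 + s * x) / (1 + s * x)\<^sup>2 = \<delta> * x ^ Suc p / (1 + s * x)"
      by (simp add: power2_eq_square)
    moreover have "K \<le> \<delta> * x ^ Suc p / (1 + s * x)"
    proof -
      have "s * x \<le> 1 * x" using s x by (intro mult_right_mono) auto
      then have "\<delta> * x ^ Suc p / (1 + x) \<le> \<delta> * x ^ Suc p / (1 + s * x)"
        using d x s by (intro divide_left_mono mult_nonneg_nonneg mult_pos_pos add_pos_nonneg) auto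
      then show ?thesis by (simp add: K_def)
    qed
    ultimately have "K \<le> Re (u ^ Suc p / v)" by linarith
    then have "K * s ^ p \<le> Re (u ^ Suc p / v) * s ^ p" using s by (intro mult_right_mono) auto
    also have "\<dots> = - Re (D (of_real s))"
    proof -
      have "D (of_real s) = - (of_real (s ^ p) * (u ^ Suc p / v))" by (simp add: D_def v_def)
      moreover have "Re (- (of_real c * w)) = - (c * Re w)" for c w by simp
      ultimately have "Re (D (of_real s)) = - (s ^ p * Re (u ^ Suc p / v))" by metis
      then show ?thesis by simp
    qed
    finally show ?thesis by simp
  qed
  \<comment> \<open>Monotonicity of \<open>G\<close> integrates \<open>ReD\<close> over
    \<open>[0, 1]\<close>; the last summand is the primitive of \<open>K * s ^ p\<close>.\<close>
  define G where "G = (\<lambda>s. Re (L (of_real s)) + K / real (Suc p) * s ^ Suc p)"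
  have "G 1 \<le> G 0"
  proof (rule DERIV_nonpos_imp_nonincreasing[of 0 1 G])
    fix s :: real assume s: "0 \<le> s" "s \<le> 1"
    have "((\<lambda>s. L (of_real s)) has_vector_derivative D (of_real s)) (at s)"
      by (rule has_vector_derivative_real_field[OF L[OF slit[OF s(1)]]])
    then have "((\<lambda>s. Re (L (of_real s))) has_vector_derivative Re (D (of_real s))) (at s)"
      by (rule bounded_linear.has_vector_derivative[OF bounded_linear_Re])
    then have 1: "((\<lambda>s. Re (L (of_real s))) has_real_derivative Re (D (of_real s))) (at s)"
      by (simp add: has_real_derivative_iff_has_vector_derivative)
    have 2: "((\<lambda>s. K / real (Suc p) * s ^ Suc p) has_real_derivative K * s ^ p) (at s)"
      by (auto intro!: derivative_eq_intros simp del: of_nat_Suc power_Suc)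
    show "\<exists>y. (G has_real_derivative y) (at s) \<and> y \<le> 0"
      using DERIV_add[OF 1 2] ReD[OF s] unfolding G_def by (intro exI conjI) auto
  qed simp
  moreover have "G 0 = 0"
  proof -
    have "(\<Sum>k=1..p. (0::complex) ^ k / of_nat k) = 0" by (intro sum.neutral) auto
    then have "L 0 = 0" by (simp add: L_def)
    then show ?thesis by (simp add: G_def)
  qed
  ultimately have "Re (L 1) \<le> - (K / real (Suc p))" by (simp add: G_def)
  moreover have "1 - u \<noteq> 0" using slit[of 1] by auto
  then have "weierstrass_factor p u = exp (L 1)"
    by (simp add: L_def weierstrass_factor_def exp_add)
  ultimately show ?thesis
    unfolding u_def[symmetric] by (simp add: norm_exp_eq_Re K_def mult.commute)
qed

text \<open>In these directions no factor exceeds 1 in modulus, so all but the first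
  \<open>N\<close> may be bounded by 1. Once \<open>t\<close> passes \<open>norm (a n)\<close>,
  \<open>x / (1 + x) \<ge> 1 / 2\<close> turns the decay of the factor into exponent
  \<open>p\<close>, and divergence lets the first \<open>N\<close> terms beat any prescribed
  \<open>S\<close>.\<close>

lemma canonical_product_decay:
  assumes p: "1 \<le> p" and P: "\<And>z. (\<lambda>n. weierstrass_factor p (z / a n)) has_prod P z"
    and div: "\<not> summable (\<lambda>n. (1 / norm (a n)) ^ p)"
    and a: "\<And>n. a n \<noteq> 0 \<Longrightarrow> a n \<in> sector \<theta>1 \<theta>2" and d: "0 < \<delta>"
    and cos: "\<And>\<theta> \<phi>. \<alpha> < \<theta> \<Longrightarrow> \<theta> < \<beta> \<Longrightarrow> \<theta>1 < \<phi> \<Longrightarrow> \<phi> < \<theta>2 \<Longrightarrow>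
      \<delta> \<le> cos (real (Suc p) * (\<theta> - \<phi>)) \<and> cos (real p * (\<theta> - \<phi>)) \<le> - \<delta>"
  shows "\<exists>R. \<forall>t \<theta>. R \<le> t \<longrightarrow> \<alpha> < \<theta> \<longrightarrow> \<theta> < \<beta> \<longrightarrow> norm (P (rcis t \<theta>)) \<le> exp (- (S * t ^ p))"
proof -
  define \<kappa> where "\<kappa> = \<delta> / (2 * real (Suc p))"
  have \<kappa>: "0 < \<kappa>" using d by (simp add: \<kappa>_def)
  have factor: "norm (weierstrass_factor p (rcis t \<theta> / a n)) \<le> 1"
    "norm (a n) \<le> t \<Longrightarrow> norm (weierstrass_factor p (rcis t \<theta> / a n)) \<le> exp (- (\<kappa> * (t / norm (a n)) ^ p))"
    if t: "0 < t" and \<theta>: "\<alpha> < \<theta>" "\<theta> < \<beta>" for t \<theta> n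
  proof -
    define x where "x = t / norm (a n)"
    have "norm (weierstrass_factor p (rcis t \<theta> / a n)) \<le> 1 \<and>
      (norm (a n) \<le> t \<longrightarrow> norm (weierstrass_factor p (rcis t \<theta> / a n)) \<le> exp (- (\<kappa> * x ^ p)))"
    proof (cases "a n = 0")
      \<comment> \<open>Padding terms: as \<open>z / 0 = 0\<close>, the factor is 1 and
        \<open>x = 0\<close>; the decay bound is then \<open>exp 0\<close> because
        \<open>p \<ge> 1\<close>.\<close>
      case True
      then show ?thesis using p by (simp add: x_def power_0_left)
    next
      case False
      then obtain r \<phi> where r: "a n = rcis r \<phi>" "0 < r" "\<theta>1 < \<phi>" "\<phi> < \<theta>2"
        using a unfolding sector_def by blast
      have na: "norm (a n) = r" using r by simp
      have x0: "0 < x" using t r na by (simp add: x_def)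
      have "rcis t \<theta> / a n = rcis x (\<theta> - \<phi>)" using r na by (simp add: rcis_divide x_def)
      then have le: "norm (weierstrass_factor p (rcis t \<theta> / a n)) \<le> exp (- (\<delta> / (real (Suc p) * (1 + x)) * x ^ Suc p))"
        using norm_weierstrass_factor_decay[OF x0 d] cos[OF \<theta> r(3,4)] by simp
      have "norm (weierstrass_factor p (rcis t \<theta> / a n)) \<le> 1"
      proof (rule order_trans[OF le])
        have "0 \<le> \<delta> / (real (Suc p) * (1 + x)) * x ^ Suc p" using d x0 by (intro mult_nonneg_nonneg divide_nonneg_nonneg) auto
        then show "exp (- (\<delta> / (real (Suc p) * (1 + x)) * x ^ Suc p)) \<le> 1" by (simp del: power_Suc)
      qed
      moreover have "norm (weierstrass_factor p (rcis t \<theta> / a n)) \<le> exp (- (\<kappa> * x ^ p))" if "norm (a n) \<le> t"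
      proof (rule order_trans[OF le])
        have "1 \<le> x" using that r na by (simp add: x_def)
        then have "1 / 2 \<le> x / (1 + x)" by (simp add: field_simps)
        then have "\<delta> / real (Suc p) * x ^ p * (1 / 2) \<le> \<delta> / real (Suc p) * x ^ p * (x / (1 + x))"
          using d x0 by (intro mult_left_mono mult_nonneg_nonneg) auto
        moreover have "\<delta> / real (Suc p) * x ^ p * (1 / 2) = \<kappa> * x ^ p" by (simp add: \<kappa>_def)
        moreover have "\<delta> / real (Suc p) * x ^ p * (x / (1 + x)) = \<delta> / (real (Suc p) * (1 + x)) * x ^ Suc p" by simp
        ultimately show "exp (- (\<delta> / (real (Suc p) * (1 + x)) * x ^ Suc p)) \<le> exp (- (\<kappa> * x ^ p))"
          unfolding exp_le_cancel_iff by linarith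
      qed
      ultimately show ?thesis by blast
    qed
    then show "norm (weierstrass_factor p (rcis t \<theta> / a n)) \<le> 1"
      "norm (a n) \<le> t \<Longrightarrow> norm (weierstrass_factor p (rcis t \<theta> / a n)) \<le> exp (- (\<kappa> * (t / norm (a n)) ^ p))"
      by (auto simp: x_def)
  qed
  have "\<exists>N. S / \<kappa> < (\<Sum>n<N. (1 / norm (a n)) ^ p)"
  proof (rule ccontr)
    assume "\<not> ?thesis"
    then have "summable (\<lambda>n. (1 / norm (a n)) ^ p)"
      by (intro summableI_nonneg_bounded[of _ "S / \<kappa>"]) (auto simp: not_less)
    with div show False by blast
  qed
  then obtain N where N: "S / \<kappa> < (\<Sum>n<N. (1 / norm (a n)) ^ p)" by blast
  show ?thesis
  proof (intro exI allI impI)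
    fix t \<theta> assume t: "1 + (\<Sum>n<N. norm (a n)) \<le> t" and \<theta>: "\<alpha> < \<theta>" "\<theta> < \<beta>"
    have t0: "0 < t" using t sum_nonneg[of "{..<N}" "\<lambda>n. norm (a n)"] by simp
    have at: "norm (a n) \<le> t" if "n < N" for n
      using t member_le_sum[of n "{..<N}" "\<lambda>n. norm (a n)"] that by simp
    define c where "c = (\<lambda>n. if n < N then - (\<kappa> * (t / norm (a n)) ^ p) else 0)"
    show "norm (P (rcis t \<theta>)) \<le> exp (- (S * t ^ p))"
    proof (rule has_prod_norm_le_exp[OF P, of "rcis t \<theta>" c N])
      show "norm (weierstrass_factor p (rcis t \<theta> / a i)) \<le> exp (c i)" for i
        using factor[OF t0 \<theta>, of i] at[of i] by (simp add: c_def)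
      fix n assume n: "N \<le> n"
      have "(\<Sum>i\<le>n. c i) = (\<Sum>i<N. c i)"
        using n by (intro sum.mono_neutral_right) (auto simp: c_def)
      also have "\<dots> = - (\<kappa> * t ^ p * (\<Sum>i<N. (1 / norm (a i)) ^ p))"
        by (simp add: c_def sum_negf sum_distrib_left power_divide)
      also have "\<dots> \<le> - (\<kappa> * t ^ p * (S / \<kappa>))"
        using N \<kappa> t0 by (intro le_imp_neg_le mult_left_mono) auto
      also have "\<dots> = - (S * t ^ p)" using \<kappa> by simp
      finally show "(\<Sum>i\<le>n. c i) \<le> - (S * t ^ p)" .
    qed
  qed
qed

text \<open>If the exponential factor had larger degree than the canonical product, it would dominate
  and the order would be that degree, an integer.\<close>
lemma genus_canonical_product:
  fixes Q :: "complex poly"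
  assumes A: "A holomorphic_on UNIV" "growth_order A = ereal \<rho>" "\<rho> \<notin> \<int>" "1 < \<rho>"
    and gen: "canonical_product_genus a k"
    and P: "\<And>z. (\<lambda>n. weierstrass_factor k (z / a n)) has_prod P z"
    and fac: "\<And>z. A z = exp (poly Q z) * P z"
  shows "degree Q \<le> k" "1 \<le> k"
proof -
  have sm: "summable (\<lambda>n. (1 / norm (a n)) ^ Suc k)"
    using gen unfolding canonical_product_genus_def by blast
  obtain C where C: "0 \<le> C" "\<And>z. norm (P z) \<le> exp (C * norm z ^ Suc k)"
    using norm_canonical_product_le[OF sm P] by blast
  have upper: "\<rho> \<le> real d" if d: "degree Q \<le> d" "Suc k \<le> d" for d
  proof -
    define S where "S = (\<Sum>i\<le>degree Q. norm (coeff Q i))"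
    have "growth_order A \<le> ereal d"
    proof (rule growth_order_le[of 1 A "S + C"])
      fix z :: complex assume z: "1 \<le> norm z"
      have "Re (poly Q z) \<le> S * norm z ^ d"
        using norm_poly_le[OF d(1) z] complex_Re_le_cmod[of "poly Q z"] unfolding S_def by linarith
      moreover have "C * norm z ^ Suc k \<le> C * norm z ^ d"
        using C(1) z d by (intro mult_left_mono power_increasing) auto
      moreover have "norm (A z) \<le> exp (Re (poly Q z)) * exp (C * norm z ^ Suc k)"
        using C(2)[of z] by (simp add: fac norm_mult norm_exp_eq_Re del: power_Suc)
      ultimately show "norm (A z) \<le> exp ((S + C) * norm z ^ d)"
        unfolding exp_add[symmetric] distrib_right
        by (smt (verit) exp_le_cancel_iff)
    qed
    with A(2) show ?thesis by simp
  qed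
  show dQ: "degree Q \<le> k"
  proof (rule ccontr)
    define d where "d = degree Q"
    assume "\<not> degree Q \<le> k"
    then have d: "Suc k \<le> d" by (simp add: d_def)
    have le: "\<rho> \<le> real d" using upper[of d] d by (simp add: d_def)
    \<comment> \<open>This makes \<open>q = d - 1\<close> at least 1, as
      \<open>norm_canonical_product_small\<close> requires.\<close>
    then have "2 \<le> d" using A(4) by linarith
    have P_eq: "P = (\<lambda>z. A z * exp (- poly Q z))" by (simp add: fac exp_minus fun_eq_iff)
    have hP: "P holomorphic_on UNIV" unfolding P_eq by (intro holomorphic_intros A(1))
    have P0: "P 0 \<noteq> 0" using has_prod_unique2[OF P[of 0], of 1] by simp
    have small: "\<exists>R. \<forall>z. R \<le> norm z \<longrightarrow> norm (P z) \<le> exp (e * norm z ^ d)" if "0 < e" for e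
    proof -
      have "max k 1 \<le> d - 1" using d \<open>2 \<le> d\<close> by auto
      from norm_canonical_product_small[OF sm P this that] show ?thesis
        using \<open>2 \<le> d\<close> by (metis Suc_diff_1 less_le_trans zero_less_numeral)
    qed
    obtain e R where "0 < e" "\<And>r. R \<le> r \<Longrightarrow> \<exists>z. norm z = r \<and> exp (e * r ^ d) \<le> norm (A z)"
      using exp_poly_mult_large[OF fac hP P0 d_def[symmetric] _ small] \<open>2 \<le> d\<close>
      by (metis one_le_numeral order_trans)
    then have "ereal d \<le> growth_order A" by (rule growth_order_ge[OF A(1)])
    with A(2) le have "\<rho> = of_nat d" by simp
    with A(3) show False by simp
  qed
  show "1 \<le> k"
  proof (rule ccontr)
    assume "\<not> 1 \<le> k"
    then have "\<rho> \<le> 1" using upper[of 1] dQ by simp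
    with A(4) show False by simp
  qed
qed

text \<open>The origin lies in no sector, so \<open>A 0 \<noteq> 0\<close> and the power of
  \<open>z\<close> in the factorization is trivial. With \<open>k = p\<close> the product decays
  like \<open>exp (- (S * t ^ p))\<close> for any \<open>S\<close>; the choice of \<open>S\<close>
  as the sum of the moduli of the coefficients of \<open>Q\<close> cancels the exponential
  factor.\<close>

lemma bounded_in_sector:
  assumes A: "A holomorphic_on UNIV" "growth_order A = ereal \<rho>" "\<rho> \<notin> \<int>" "1 < \<rho>"
    and gen: "has_genus A p"
    and zeros: "\<And>z. A z = 0 \<Longrightarrow> z \<in> sector \<theta>1 \<theta>2"
    and width: "odd p \<Longrightarrow> \<theta>2 - \<theta>1 < pi / (real p + 1)"
      "even p \<Longrightarrow> \<theta>2 - \<theta>1 < (2 * real p - 1) * pi / (2 * real p * (real p + 1))"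
  obtains \<alpha> \<beta> R where "\<alpha> < \<beta>" "\<And>t \<theta>. R \<le> t \<Longrightarrow> \<alpha> < \<theta> \<Longrightarrow> \<theta> < \<beta> \<Longrightarrow> norm (A (rcis t \<theta>)) \<le> 1"
proof -
  obtain m Q a k P where gk: "canonical_product_genus a k"
    and P: "\<And>z. (\<lambda>n. weierstrass_factor k (z / a n)) has_prod P z"
    and fac: "\<And>z. A z = z ^ m * exp (poly Q z) * P z" and pk: "p = max (degree Q) k"
    using gen unfolding has_genus_def by blast
  have "0 \<notin> sector \<theta>1 \<theta>2" unfolding sector_def by (auto simp: rcis_def)
  then have "A 0 \<noteq> 0" using zeros by blast
  then have "m = 0" using fac[of 0] by (cases m) auto
  then have fac': "\<And>z. A z = exp (poly Q z) * P z" using fac by simp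
  note k = genus_canonical_product[OF A gk P fac']
  have kp: "k = p" and p: "1 \<le> p" and dQ: "degree Q \<le> p" using k pk by auto
  have az: "a n \<in> sector \<theta>1 \<theta>2" if "a n \<noteq> 0" for n
  proof -
    have "P (a n) = 0"
      using has_prod_eq_0_iff[OF P[of "a n"]] that by (auto intro!: exI[of _ n])
    then show ?thesis using zeros fac' by simp
  qed
  have "\<forall>j<k. \<not> summable (\<lambda>n. (1 / norm (a n)) ^ Suc j)"
    using gk unfolding canonical_product_genus_def by (rule conjunct2)
  moreover have "p - 1 < k" "Suc (p - 1) = p" using p kp by auto
  ultimately have div: "\<not> summable (\<lambda>n. (1 / norm (a n)) ^ p)" by metis
  \<comment> \<open>No hypothesis says \<open>\<theta>1 < \<theta>2\<close>; it follows because
    divergence forces a zero to exist in the sector.\<close>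
  have "\<exists>n. a n \<noteq> 0"
  proof (rule ccontr)
    assume "\<not> ?thesis"
    then have "(\<lambda>n. (1 / norm (a n)) ^ p) = (\<lambda>n. 0)" using p by (simp add: power_0_left)
    with div show False by simp
  qed
  then have "\<theta>1 < \<theta>2" using az unfolding sector_def by fastforce
  then obtain \<alpha> \<beta> \<delta> where ab: "\<alpha> < \<beta>" "0 < \<delta>"
    "\<And>\<theta> \<phi>. \<alpha> < \<theta> \<Longrightarrow> \<theta> < \<beta> \<Longrightarrow> \<theta>1 < \<phi> \<Longrightarrow> \<phi> < \<theta>2 \<Longrightarrow>
      \<delta> \<le> cos (real (Suc p) * (\<theta> - \<phi>)) \<and> cos (real p * (\<theta> - \<phi>)) \<le> - \<delta>"
    using decay_sector[OF p _ width] by metis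
  define S where "S = (\<Sum>i\<le>degree Q. norm (coeff Q i))"
  have "\<exists>R. \<forall>t \<theta>. R \<le> t \<longrightarrow> \<alpha> < \<theta> \<longrightarrow> \<theta> < \<beta> \<longrightarrow> norm (P (rcis t \<theta>)) \<le> exp (- (S * t ^ p))"
    by (rule canonical_product_decay[OF p P[unfolded kp] div, of \<theta>1 \<theta>2 \<delta> \<alpha> \<beta>])
      (erule az | rule ab(2) | rule ab(3); assumption)+
  then obtain R where R: "\<And>t \<theta>. R \<le> t \<Longrightarrow> \<alpha> < \<theta> \<Longrightarrow> \<theta> < \<beta> \<Longrightarrow> norm (P (rcis t \<theta>)) \<le> exp (- (S * t ^ p))"
    by blast
  show thesis
  proof (rule that[OF ab(1), of "max 1 R"])
    fix t \<theta> assume t: "max 1 R \<le> t" and \<theta>: "\<alpha> < \<theta>" "\<theta> < \<beta>"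
    have "norm (poly Q (rcis t \<theta>)) \<le> S * t ^ p"
      using norm_poly_le[OF dQ, of "rcis t \<theta>"] t unfolding S_def by simp
    then have "Re (poly Q (rcis t \<theta>)) \<le> S * t ^ p"
      using complex_Re_le_cmod order_trans by blast
    then have "norm (A (rcis t \<theta>)) \<le> exp (S * t ^ p) * exp (- (S * t ^ p))"
      unfolding fac' norm_mult norm_exp_eq_Re using R[of t \<theta>] t \<theta> by (intro mult_mono) auto
    then show "norm (A (rcis t \<theta>)) \<le> 1" by (simp add: exp_minus)
  qed
qed

theorem theorem5:
  fixes A B f :: "complex \<Rightarrow> complex" and \<rho> \<theta>1 \<theta>2 :: real and p :: nat
  assumes "A holomorphic_on UNIV"
    and "growth_order A = ereal \<rho>" and "\<rho> \<notin> \<int>" and "1 < \<rho>"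
    and "has_genus A p"
    and "\<And>z. A z = 0 \<Longrightarrow> z \<in> sector \<theta>1 \<theta>2"
    and "odd p \<Longrightarrow> \<theta>2 - \<theta>1 < pi / (real p + 1)"
    and "even p \<Longrightarrow> \<theta>2 - \<theta>1 < (2 * real p - 1) * pi / (2 * real p * (real p + 1))"
    and "transcendental_entire B"
    and "\<exists>U \<in> components (Fatou_set B). \<not> simply_connected U"
    and "f holomorphic_on UNIV"
    and "\<And>z. deriv (deriv f) z + A z * deriv f z + B z * f z = 0"
    and "\<exists>z. f z \<noteq> 0"
  shows "growth_order f = \<infinity>"
proof (rule ccontr)
  assume fin: "growth_order f \<noteq> \<infinity>"
  obtain \<alpha> \<beta> RA where ab: "\<alpha> < \<beta>"
    and A: "\<And>t \<theta>. RA \<le> t \<Longrightarrow> \<alpha> < \<theta> \<Longrightarrow> \<theta> < \<beta> \<Longrightarrow> norm (A (rcis t \<theta>)) \<le> 1"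
    using bounded_in_sector[OF assms(1-8)] by blast
  obtain q Rf where gr: "\<And>z. Rf \<le> norm z \<Longrightarrow> norm (f z) \<le> exp (norm z ^ q)"
    using finite_growth_order_bound[OF assms(11) fin] by blast
  obtain c where c: "f c \<noteq> 0" using assms(13) by blast
  obtain K R0 where K: "\<And>R. R0 \<le> R \<Longrightarrow> \<exists>\<theta>. \<alpha> < \<theta> \<and> \<theta> < \<beta> \<and> (\<forall>t. 1 \<le> t \<and> t \<le> R \<longrightarrow>
    f (rcis t \<theta>) \<noteq> 0 \<and> norm (deriv f (rcis t \<theta>)) \<le> R ^ K * norm (f (rcis t \<theta>)) \<and>
    norm (deriv (deriv f) (rcis t \<theta>)) \<le> R ^ K * norm (f (rcis t \<theta>)))"
    by (rule derivatives_bound_on_ray[OF assms(11) c ab gr], assumption, rule that)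
  obtain U where U: "U \<in> components (Fatou_set B)" "\<not> simply_connected U" using assms(10) by blast
  obtain C :: nat where C: "\<And>K R. \<exists>m\<ge>R. \<forall>\<theta>. \<exists>t. m \<le> t \<and> t \<le> m ^ C \<and> m ^ K \<le> norm (B (rcis t \<theta>))"
    using large_on_rays[OF assms(9) U] by blast
  define R1 where "R1 = max 3 (max R0 RA)"
  \<comment> \<open>On moduli up to \<open>m ^ C\<close> the quotients are bounded by
    \<open>m ^ (C * K)\<close>, so the equation with \<open>norm (A z) \<le> 1\<close> gives
    \<open>norm (B z) \<le> 2 * m ^ (C * K)\<close>; one further power of \<open>m \<ge> 3\<close>
    contradicts this.\<close>
  obtain m where m: "R1 \<le> m" "\<And>\<theta>. \<exists>t. m \<le> t \<and> t \<le> m ^ C \<and> m ^ (C * K + 1) \<le> norm (B (rcis t \<theta>))"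
    using C[of R1 "C * K + 1"] by blast
  have m3: "3 \<le> m" "R0 \<le> m" "RA \<le> m" using m(1) by (auto simp: R1_def)
  have "m \<le> m ^ C" using m(2)[of 0] by fastforce
  then have "R0 \<le> m ^ C" using m3 by linarith
  from K[OF this] obtain \<theta> where \<theta>: "\<alpha> < \<theta>" "\<theta> < \<beta>" and bound: "\<forall>t. 1 \<le> t \<and> t \<le> m ^ C \<longrightarrow>
    f (rcis t \<theta>) \<noteq> 0 \<and> norm (deriv f (rcis t \<theta>)) \<le> (m ^ C) ^ K * norm (f (rcis t \<theta>)) \<and>
    norm (deriv (deriv f) (rcis t \<theta>)) \<le> (m ^ C) ^ K * norm (f (rcis t \<theta>))"
    by blast
  from m(2)[of \<theta>] obtain t where t: "m \<le> t" "t \<le> m ^ C" "m ^ (C * K + 1) \<le> norm (B (rcis t \<theta>))"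
    by blast
  define z where "z = rcis t \<theta>"
  define M where "M = m ^ (C * K)"
  have M: "0 < M" using m3 by (simp add: M_def)
  have fz: "f z \<noteq> 0" "norm (deriv f z) \<le> M * norm (f z)" "norm (deriv (deriv f) z) \<le> M * norm (f z)"
    using bound[rule_format, of t] t m3 by (auto simp: z_def M_def power_mult)
  have Az: "norm (A z) \<le> 1" using A[of t \<theta>] t m3 \<theta> by (simp add: z_def)
  have "B z * f z = - (deriv (deriv f) z + A z * deriv f z)"
    using assms(12)[of z] by (simp add: add_eq_0_iff)
  then have "norm (B z) * norm (f z) = norm (deriv (deriv f) z + A z * deriv f z)"
    by (metis norm_minus_cancel norm_mult)
  also have "\<dots> \<le> norm (deriv (deriv f) z) + norm (A z) * norm (deriv f z)"
    using norm_triangle_ineq[of "deriv (deriv f) z" "A z * deriv f z"] by (simp add: norm_mult)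
  also have "\<dots> \<le> M * norm (f z) + 1 * (M * norm (f z))"
    using fz Az M by (intro add_mono mult_mono) auto
  finally have "norm (B z) * norm (f z) \<le> (2 * M) * norm (f z)" by simp
  then have "norm (B z) \<le> 2 * M" using fz(1) by simp
  moreover have "m * M \<le> norm (B z)" using t(3) by (simp add: z_def M_def)
  moreover have "3 * M \<le> m * M" using m3 M by (intro mult_right_mono) auto
  ultimately show False using M by linarith
qed

end
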